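(* Let $k$ be an algebraically closed field of characteristic $p>0$ and let $n$ be a positive integer with $p\mid n$. For generic $c\in k$ (i.e. for all $c\in k$ outside some finite subset of $k$), the quotient $A/I_c$, where $I_c=\langle f_1,\ldots,f_{n-1}\rangle$, is a complete intersection.
   Context: $A=k[x_1,\ldots,x_n]/(x_1+\cdots+x_n)$, a polynomial ring in $n-1$ variables, graded with $\deg x_i=1$ (images of the $x_i$ are still denoted $x_i$). For a formal power series $r(z)$, $[z^l]r(z)$ denotes the coefficient of $z^l$. Rational functions in $z$ are expanded around $z=0$. For $c\in k$ and $i=1,\ldots,n-1$, put in $A[[z]]$ $$F_i(z)=\frac{1}{1-x_iz}\sum_{m=0}^{p-1}\binom{c}{m}\left(\prod_{j=1}^n(1-x_jz)-1\right)^m,\qquad \binom{c}{m}=\frac{c(c-1)\cdots(c-m+1)}{m!}\in k,$$ and $f_i=[z^p]F_i(z)\in A$. Each $f_i$ is homogeneous of degree $p$, and $I_c\subset A$ is the homogeneous ideal generated by $f_1,\ldots,f_{n-1}$. Complete intersection: for a homogeneous ideal $I\subset k[X_0,\ldots,X_m]$ with a minimal set of generators of size $l$, the quotient $k[X_0,\ldots,X_m]/I$ is called a complete intersection if the closed projective subvariety of $\mathbb{P}^m$ defined by $I$ has dimension $m-l$ (the empty variety having dimension $-1$). Here this is applied to $A$ viewed as a polynomial ring in $n-1$ variables ($m=n-2$). *)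

theory Defs
  imports
    "HOL-Library.Poly_Mapping"
    "HOL-Computational_Algebra.Formal_Power_Series"
    "HOL-Computational_Algebra.Polynomial"
    "HOL-Algebra.QuotRing"
begin

section \<open>Polynomial rings over a field\<close>

text \<open>
  A polynomial in the variables \<open>X 0, X 1, \<dots>\<close> is a finitely supported map from exponent
  vectors to coefficients; \<open>mpoly_ring V\<close> is the subring \<open>k[X i | i \<in> V]\<close>, so that ideals are
  always taken inside a polynomial ring with the prescribed variables.
\<close>

type_synonym 'k mpoly = "(nat \<Rightarrow>\<^sub>0 nat) \<Rightarrow>\<^sub>0 'k"

definition mvar :: "nat \<Rightarrow> 'k::field mpoly" where
  "mvar i = Poly_Mapping.single (Poly_Mapping.single i 1) 1"

definition mconst :: "'k \<Rightarrow> 'k::field mpoly" where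
  "mconst a = Poly_Mapping.single 0 a"

definition mvars :: "'k::field mpoly \<Rightarrow> nat set" where
  "mvars f = (\<Union>m\<in>Poly_Mapping.keys f. Poly_Mapping.keys m)"

definition mpoly_ring :: "nat set \<Rightarrow> 'k::field mpoly ring" where
  "mpoly_ring V = \<lparr>carrier = {f. mvars f \<subseteq> V}, mult = (*), one = 1, zero = 0, add = (+)\<rparr>"

definition homogeneous :: "nat \<Rightarrow> 'k::field mpoly \<Rightarrow> bool" where
  "homogeneous d f \<longleftrightarrow>
    (\<forall>m\<in>Poly_Mapping.keys f. (\<Sum>i\<in>Poly_Mapping.keys m. Poly_Mapping.lookup m i) = d)"

definition msubst :: "('k::field \<Rightarrow> 'b::comm_ring_1) \<Rightarrow> (nat \<Rightarrow> 'b) \<Rightarrow> 'k mpoly \<Rightarrow> 'b" where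
  "msubst \<phi> \<sigma> f = (\<Sum>m\<in>Poly_Mapping.keys f. \<phi> (Poly_Mapping.lookup f m) *
      (\<Prod>i\<in>Poly_Mapping.keys m. \<sigma> i ^ Poly_Mapping.lookup m i))"

abbreviation meval :: "(nat \<Rightarrow> 'k::field) \<Rightarrow> 'k mpoly \<Rightarrow> 'k" where
  "meval \<equiv> msubst (\<lambda>a. a)"


section \<open>Projective space, Krull dimension, complete intersections\<close>

text \<open>
  The projective space with homogeneous coordinates \<open>X i\<close>, \<open>i \<in> V\<close>, is
  \<open>\<bbbP>\<^sup>m\<close> for \<open>m = card V - 1\<close>.
\<close>

definition nonzero_vectors :: "nat set \<Rightarrow> (nat \<Rightarrow> 'k::field) set" where
  "nonzero_vectors V = {x. (\<forall>i. i \<notin> V \<longrightarrow> x i = 0) \<and> (\<exists>i. x i \<noteq> 0)}"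

definition proj_space :: "nat set \<Rightarrow> (nat \<Rightarrow> 'k::field) set set" where
  "proj_space V = nonzero_vectors V //
     {(x, y). x \<in> nonzero_vectors V \<and> y \<in> nonzero_vectors V \<and>
              (\<exists>t. t \<noteq> 0 \<and> y = (\<lambda>i. t * x i))}"

text \<open>
  A point is the set of all its coordinate vectors. For homogeneous \<open>f\<close>, vanishing at one of
  them is the same as vanishing at all of them; for a homogeneous ideal over an infinite field,
  the definition therefore gives the common zeros of the homogeneous elements.
\<close>

definition proj_zeros :: "nat set \<Rightarrow> 'k::field mpoly set \<Rightarrow> (nat \<Rightarrow> 'k) set set" where
  "proj_zeros V S = {P \<in> proj_space V. \<forall>f\<in>S. \<forall>x\<in>P. meval x f = 0}"

definition zariski_closed :: "nat set \<Rightarrow> (nat \<Rightarrow> 'k::field) set set \<Rightarrow> bool" where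
  "zariski_closed V Z \<longleftrightarrow>
    (\<exists>S \<subseteq> carrier (mpoly_ring V). (\<forall>f\<in>S. \<exists>d. homogeneous d f) \<and> Z = proj_zeros V S)"

definition irreducible_closed :: "nat set \<Rightarrow> (nat \<Rightarrow> 'k::field) set set \<Rightarrow> bool" where
  "irreducible_closed V Z \<longleftrightarrow> zariski_closed V Z \<and> Z \<noteq> {} \<and>
    (\<forall>Z1 Z2. zariski_closed V Z1 \<longrightarrow> zariski_closed V Z2 \<longrightarrow> Z = Z1 \<union> Z2 \<longrightarrow> Z = Z1 \<or> Z = Z2)"

text \<open>
  The Krull dimension of \<open>X\<close> is the supremum of the lengths \<open>d\<close> of chains
  \<open>Z 0 \<subset> \<dots> \<subset> Z d\<close> of irreducible closed subsets of \<open>X\<close>. A chain of length \<open>d\<close> contains chains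
  of all smaller lengths, so the supremum is \<open>e\<close> iff exactly the lengths up to \<open>e\<close> occur; the
  empty set, which has no chains at all, gets dimension \<open>-1\<close>.
\<close>

definition irreducible_chain :: "nat set \<Rightarrow> (nat \<Rightarrow> 'k::field) set set \<Rightarrow> nat \<Rightarrow> bool" where
  "irreducible_chain V X d \<longleftrightarrow>
     (\<exists>Z. (\<forall>i\<le>d. irreducible_closed V (Z i) \<and> Z i \<subseteq> X) \<and> (\<forall>i<d. Z i \<subset> Z (Suc i)))"

definition has_proj_dim :: "nat set \<Rightarrow> (nat \<Rightarrow> 'k::field) set set \<Rightarrow> int \<Rightarrow> bool" where
  "has_proj_dim V X e \<longleftrightarrow> e \<ge> -1 \<and> (\<forall>d. irreducible_chain V X d \<longleftrightarrow> int d \<le> e)"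

text \<open>
  Generators of homogeneous ideals are understood to be homogeneous: otherwise the number of
  elements of an irredundant generating set would not be an invariant of the ideal, e.g.
  \<open>\<langle>X\<rangle> = \<langle>X\<^sup>2, X - X\<^sup>2\<rangle>\<close>. Being a complete intersection is a property of the quotient by
  \<open>I\<close>, stated here as a predicate of \<open>I\<close> (homogeneous by the existence of \<open>G\<close>).
\<close>

definition minimal_generators :: "nat set \<Rightarrow> 'k::field mpoly set \<Rightarrow> 'k mpoly set \<Rightarrow> bool" where
  "minimal_generators V I G \<longleftrightarrow>
     finite G \<and> G \<subseteq> carrier (mpoly_ring V) \<and> (\<forall>g\<in>G. \<exists>d. homogeneous d g) \<and>
     genideal (mpoly_ring V) G = I \<and>
     (\<forall>G'. G' \<subset> G \<longrightarrow> genideal (mpoly_ring V) G' \<noteq> I)"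

definition complete_intersection :: "nat set \<Rightarrow> 'k::field mpoly set \<Rightarrow> bool" where
  "complete_intersection V I \<longleftrightarrow>
     (\<exists>G. minimal_generators V I G \<and>
          has_proj_dim V (proj_zeros V I) ((int (card V) - 1) - int (card G)))"


section \<open>The ring \<open>A = k[x\<^sub>1, \<dots>, x\<^sub>n] / (x\<^sub>1 + \<dots> + x\<^sub>n)\<close> and the ideal \<open>I\<^sub>c\<close>\<close>

text \<open>
  \<open>A\<close> is viewed as the polynomial ring \<open>k[x\<^sub>1, \<dots>, x\<^sub>n\<^sub>-\<^sub>1]\<close>, in which the image of \<open>x\<^sub>n\<close> is
  \<open>-(x\<^sub>1 + \<dots> + x\<^sub>n\<^sub>-\<^sub>1)\<close>. That this is the quotient ring, with \<open>xA n i\<close> corresponding to the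
  class of \<open>x\<^sub>i\<close>, is proved in \<open>A_iso_quotient\<close> below.
\<close>

definition A_ring :: "nat \<Rightarrow> 'k::field mpoly ring" where
  "A_ring n = mpoly_ring {1..n-1}"

definition xA :: "nat \<Rightarrow> nat \<Rightarrow> 'k::field mpoly" where
  "xA n i = (if i = n then - (\<Sum>j=1..n-1. mvar j) else mvar i)"

text \<open>The library's binomial coefficient \<open>gchoose\<close> is restricted to characteristic zero.\<close>

definition binom :: "'k::field \<Rightarrow> nat \<Rightarrow> 'k" where
  "binom c m = (\<Prod>i<m. c - of_nat i) / of_nat (fact m)"

definition lin_fps :: "'k::field mpoly \<Rightarrow> 'k mpoly fps" where
  "lin_fps a = 1 - fps_const a * fps_X"

text \<open>
  \<open>fps_right_inverse f 1\<close> is the inverse of a power series \<open>f\<close> with constant coefficient \<open>1\<close>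
  (the operation \<open>inverse\<close> on power series is not available over \<open>A\<close>).
\<close>

definition F_fps :: "nat \<Rightarrow> nat \<Rightarrow> 'k::field \<Rightarrow> nat \<Rightarrow> 'k mpoly fps" where
  "F_fps p n c i = fps_right_inverse (lin_fps (xA n i)) 1 *
     (\<Sum>m=0..p-1. fps_const (mconst (binom c m)) * ((\<Prod>j=1..n. lin_fps (xA n j)) - 1) ^ m)"

definition f_gen :: "nat \<Rightarrow> nat \<Rightarrow> 'k::field \<Rightarrow> nat \<Rightarrow> 'k mpoly" where
  "f_gen p n c i = fps_nth (F_fps p n c i) p"

definition I_ideal :: "nat \<Rightarrow> nat \<Rightarrow> 'k::field \<Rightarrow> 'k mpoly set" where
  "I_ideal p n c = genideal (A_ring n) (f_gen p n c ` {1..n-1})"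

lemma F_fps_mult: "lin_fps (xA n i) * F_fps p n c i =
  (\<Sum>m=0..p-1. fps_const (mconst (binom c m)) * ((\<Prod>j=1..n. lin_fps (xA n j)) - 1) ^ m)"
proof -
  have "lin_fps (xA n i) * fps_right_inverse (lin_fps (xA n i)) 1 = (1 :: 'a mpoly fps)"
    by (rule fps_right_inverse) (simp add: lin_fps_def)
  then show ?thesis
    by (simp add: F_fps_def mult.assoc[symmetric])
qed


section \<open>Identification of \<open>A\<close> with the quotient ring\<close>

lemma mpoly_ring_simps [simp]:
  "carrier (mpoly_ring V) = {f. mvars f \<subseteq> V}"
  "mult (mpoly_ring V) = (*)" "one (mpoly_ring V) = 1"
  "zero (mpoly_ring V) = 0" "add (mpoly_ring V) = (+)"
  by (simp_all add: mpoly_ring_def)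

lemma mvars_zero [simp]: "mvars 0 = {}" and mvars_one [simp]: "mvars 1 = {}"
  by (simp_all add: mvars_def)

lemma mvars_single: "mvars (Poly_Mapping.single m a) \<subseteq> Poly_Mapping.keys m"
  by (auto simp: mvars_def split: if_splits)

lemma mvars_mvar: "mvars (mvar i) \<subseteq> {i}"
  using mvars_single[of "Poly_Mapping.single i 1" 1] by (auto simp: mvar_def split: if_splits)

lemma mvars_uminus [simp]: "mvars (- f) = mvars f"
  by (auto simp: mvars_def in_keys_iff)

lemma mvars_add: "mvars (f + g) \<subseteq> mvars f \<union> mvars g"
  using Poly_Mapping.keys_add[of f g] by (fastforce simp: mvars_def)

lemma mvars_mult: "mvars (f * g) \<subseteq> mvars f \<union> mvars g"
proof
  fix i assume "i \<in> mvars (f * g)"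
  then obtain m where m: "m \<in> Poly_Mapping.keys (f * g)" "i \<in> Poly_Mapping.keys m"
    by (auto simp: mvars_def)
  then obtain a b where "a \<in> Poly_Mapping.keys f" "b \<in> Poly_Mapping.keys g" "m = a + b"
    using keys_mult[of f g] by blast
  then show "i \<in> mvars f \<union> mvars g"
    using m(2) Poly_Mapping.keys_add[of a b] by (fastforce simp: mvars_def)
qed

lemma mvars_sum: "(\<And>a. a \<in> S \<Longrightarrow> mvars (h a) \<subseteq> V) \<Longrightarrow> mvars (sum h S) \<subseteq> V"
proof (induction S rule: infinite_finite_induct)
  case (insert a S)
  then show ?case using mvars_add[of "h a" "sum h S"] by auto
qed auto

lemma mpoly_ring_cring: "cring (mpoly_ring V :: 'k::field mpoly ring)"
proof (rule cringI)
  show "abelian_group (mpoly_ring V :: 'k mpoly ring)"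
  proof (rule abelian_groupI)
    fix x :: "'k mpoly" assume "x \<in> carrier (mpoly_ring V)"
    then show "\<exists>y\<in>carrier (mpoly_ring V). y \<oplus>\<^bsub>mpoly_ring V\<^esub> x = \<zero>\<^bsub>mpoly_ring V\<^esub>"
      by (intro bexI[of _ "- x"]) auto
  next
    fix x y :: "'k mpoly"
    assume "x \<in> carrier (mpoly_ring V)" "y \<in> carrier (mpoly_ring V)"
    then show "x \<oplus>\<^bsub>mpoly_ring V\<^esub> y \<in> carrier (mpoly_ring V)"
      using mvars_add[of x y] by auto
  qed (auto simp: add_ac)
  show "comm_monoid (mpoly_ring V :: 'k mpoly ring)"
  proof (rule comm_monoidI)
    fix x y :: "'k mpoly"
    assume "x \<in> carrier (mpoly_ring V)" "y \<in> carrier (mpoly_ring V)"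
    then show "x \<otimes>\<^bsub>mpoly_ring V\<^esub> y \<in> carrier (mpoly_ring V)"
      using mvars_mult[of x y] by auto
  qed (auto simp: mult_ac)
qed (auto simp: distrib_right)

lemma mpoly_decomp:
  "f = (\<Sum>m\<in>Poly_Mapping.keys f. Poly_Mapping.single m (Poly_Mapping.lookup f m))"
  by (rule poly_mapping_eqI)
     (auto simp: lookup_sum lookup_single when_def sum.delta in_keys_iff)

lemma msubst_superset:
  assumes "finite S" "Poly_Mapping.keys f \<subseteq> S" "\<phi> 0 = 0"
  shows "msubst \<phi> \<sigma> f = (\<Sum>m\<in>S. \<phi> (Poly_Mapping.lookup f m) *
      (\<Prod>i\<in>Poly_Mapping.keys m. \<sigma> i ^ Poly_Mapping.lookup m i))"
  unfolding msubst_def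
  by (rule sum.mono_neutral_left) (use assms in \<open>auto simp: in_keys_iff\<close>)

lemma mono_superset:
  fixes \<sigma> :: "nat \<Rightarrow> 'b::comm_ring_1"
  assumes "finite S" "Poly_Mapping.keys m \<subseteq> S"
  shows "(\<Prod>i\<in>Poly_Mapping.keys m. \<sigma> i ^ Poly_Mapping.lookup m i) =
         (\<Prod>i\<in>S. \<sigma> i ^ Poly_Mapping.lookup m i)"
  by (rule prod.mono_neutral_left) (use assms in \<open>auto simp: in_keys_iff\<close>)

lemma mono_add:
  fixes \<sigma> :: "nat \<Rightarrow> 'b::comm_ring_1"
  shows "(\<Prod>i\<in>Poly_Mapping.keys (a + b). \<sigma> i ^ Poly_Mapping.lookup (a + b) i) =
    (\<Prod>i\<in>Poly_Mapping.keys a. \<sigma> i ^ Poly_Mapping.lookup a i) *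
    (\<Prod>i\<in>Poly_Mapping.keys b. \<sigma> i ^ Poly_Mapping.lookup b i)"
proof -
  let ?S = "Poly_Mapping.keys a \<union> Poly_Mapping.keys b"
  have "Poly_Mapping.keys (a + b) \<subseteq> ?S" by (rule Poly_Mapping.keys_add)
  then have "(\<Prod>i\<in>Poly_Mapping.keys (a + b). \<sigma> i ^ Poly_Mapping.lookup (a + b) i) =
      (\<Prod>i\<in>?S. \<sigma> i ^ Poly_Mapping.lookup (a + b) i)"
    by (intro mono_superset) auto
  also have "\<dots> = (\<Prod>i\<in>?S. \<sigma> i ^ Poly_Mapping.lookup a i) * (\<Prod>i\<in>?S. \<sigma> i ^ Poly_Mapping.lookup b i)"
    by (simp add: lookup_add power_add prod.distrib)
  also have "(\<Prod>i\<in>?S. \<sigma> i ^ Poly_Mapping.lookup a i) =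
      (\<Prod>i\<in>Poly_Mapping.keys a. \<sigma> i ^ Poly_Mapping.lookup a i)"
    by (rule mono_superset[symmetric]) auto
  also have "(\<Prod>i\<in>?S. \<sigma> i ^ Poly_Mapping.lookup b i) =
      (\<Prod>i\<in>Poly_Mapping.keys b. \<sigma> i ^ Poly_Mapping.lookup b i)"
    by (rule mono_superset[symmetric]) auto
  finally show ?thesis .
qed

locale coeff_hom =
  fixes \<phi> :: "'k::field \<Rightarrow> 'b::comm_ring_1"
  assumes zero: "\<phi> 0 = 0" and one: "\<phi> 1 = 1"
    and add: "\<phi> (a + b) = \<phi> a + \<phi> b" and mult: "\<phi> (a * b) = \<phi> a * \<phi> b"
begin

lemma msubst_zero: "msubst \<phi> \<sigma> 0 = 0"
  by (simp add: msubst_def)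

lemma msubst_add: "msubst \<phi> \<sigma> (f + g) = msubst \<phi> \<sigma> f + msubst \<phi> \<sigma> g"
proof -
  let ?S = "Poly_Mapping.keys f \<union> Poly_Mapping.keys g"
  have "Poly_Mapping.keys (f + g) \<subseteq> ?S" by (rule Poly_Mapping.keys_add)
  then show ?thesis
    by (simp add: msubst_superset[of ?S] zero lookup_add add distrib_right sum.distrib)
qed

lemma msubst_sum: "msubst \<phi> \<sigma> (sum h S) = (\<Sum>a\<in>S. msubst \<phi> \<sigma> (h a))"
  by (induction S rule: infinite_finite_induct) (auto simp: msubst_zero msubst_add)

lemma msubst_single: "msubst \<phi> \<sigma> (Poly_Mapping.single m a) =
    \<phi> a * (\<Prod>i\<in>Poly_Mapping.keys m. \<sigma> i ^ Poly_Mapping.lookup m i)"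
  by (subst msubst_superset[of "{m}"]) (auto simp: zero)

lemma msubst_one: "msubst \<phi> \<sigma> 1 = 1"
  using msubst_single[of \<sigma> 0 1] by (simp add: one)

lemma msubst_mvar: "msubst \<phi> \<sigma> (mvar i) = \<sigma> i"
  by (simp add: mvar_def msubst_single one)

lemma msubst_mult: "msubst \<phi> \<sigma> (f * g) = msubst \<phi> \<sigma> f * msubst \<phi> \<sigma> g"
proof -
  have "f * g = (\<Sum>m\<in>Poly_Mapping.keys f. \<Sum>l\<in>Poly_Mapping.keys g.
      Poly_Mapping.single (m + l) (Poly_Mapping.lookup f m * Poly_Mapping.lookup g l))"
    by (subst mpoly_decomp[of f], subst mpoly_decomp[of g])
       (simp add: sum_product mult_single)
  then show ?thesis
    by (simp add: msubst_sum msubst_single mono_add mult msubst_def[of _ _ f] msubst_def[of _ _ g]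
        sum_product mult_ac)
qed

lemma msubst_uminus: "msubst \<phi> \<sigma> (- f) = - msubst \<phi> \<sigma> f"
  using msubst_add[of \<sigma> f "- f"] by (simp add: msubst_zero eq_neg_iff_add_eq_0 add.commute)

end

lemma coeff_hom_id: "coeff_hom (\<lambda>a::'k::field. a)"
  by unfold_locales auto

lemma coeff_hom_mconst: "coeff_hom (mconst :: 'k::field \<Rightarrow> 'k mpoly)"
  by unfold_locales (auto simp: mconst_def single_add mult_single)

definition to_A :: "nat \<Rightarrow> 'k::field mpoly \<Rightarrow> 'k mpoly" where
  "to_A n = msubst mconst (xA n)"

lemma mconst_mvar_mono:
  "mconst a * (\<Prod>i\<in>Poly_Mapping.keys m. mvar i ^ Poly_Mapping.lookup m i)
     = Poly_Mapping.single m (a::'k::field)"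
proof -
  have pow: "mvar i ^ e = (Poly_Mapping.single (Poly_Mapping.single i e) 1 :: 'k mpoly)" for i e
    by (induction e) (simp_all add: mvar_def mult_single single_add[symmetric])
  have "(\<Prod>i\<in>S. mvar i ^ Poly_Mapping.lookup m i) = (Poly_Mapping.single
     (\<Sum>i\<in>S. Poly_Mapping.single i (Poly_Mapping.lookup m i)) 1 :: 'k mpoly)" for S
    by (induction S rule: infinite_finite_induct) (simp_all add: pow mult_single)
  moreover have "(\<Sum>i\<in>Poly_Mapping.keys m. Poly_Mapping.single i (Poly_Mapping.lookup m i)) = m"
    by (rule poly_mapping_eqI)
       (auto simp: lookup_sum lookup_single when_def sum.delta in_keys_iff)
  ultimately show ?thesis by (simp add: mconst_def mult_single)
qed

lemma msubst_mvar_id: "msubst mconst mvar f = f"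
  by (subst (2) mpoly_decomp[of f]) (simp add: msubst_def mconst_mvar_mono)

lemma msubst_cong: "(\<And>i. i \<in> mvars f \<Longrightarrow> \<sigma> i = \<tau> i) \<Longrightarrow> msubst \<phi> \<sigma> f = msubst \<phi> \<tau> f"
  unfolding msubst_def
  by (intro sum.cong refl arg_cong2[where f = "(*)"] prod.cong arg_cong2[where f = "(^)"])
     (auto simp: mvars_def)

lemma to_A_id: "f \<in> carrier (A_ring n) \<Longrightarrow> n > 0 \<Longrightarrow> to_A n f = f"
  by (subst (2) msubst_mvar_id[symmetric], unfold to_A_def, rule msubst_cong)
     (force simp: A_ring_def xA_def)

lemma xA_carrier:
  assumes "i \<in> {1..n}" shows "mvars (xA n i :: 'k::field mpoly) \<subseteq> {1..n-1}"
proof (cases "i = n")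
  case True
  have "mvars (\<Sum>j=1..n-1. mvar j :: 'k mpoly) \<subseteq> {1..n-1}"
    by (rule mvars_sum) (use mvars_mvar in fastforce)
  with True show ?thesis by (simp add: xA_def)
next
  case False
  then have "i \<in> {1..n-1}" using assms by auto
  with False show ?thesis using mvars_mvar[where i = i and 'a = 'k] by (auto simp: xA_def)
qed

lemma mvars_power: "mvars (f ^ e) \<subseteq> mvars f"
  by (induction e) (use mvars_mult in force)+

lemma mvars_prod: "(\<And>a. a \<in> S \<Longrightarrow> mvars (h a) \<subseteq> V) \<Longrightarrow> mvars (prod h S) \<subseteq> V"
proof (induction S rule: infinite_finite_induct)
  case (insert a S)
  then show ?case using mvars_mult[of "h a" "prod h S"] by auto
qed auto

lemma mvars_mconst [simp]: "mvars (mconst a) = {}"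
  using mvars_single[of 0 a] by (auto simp: mconst_def)

lemma to_A_carrier:
  assumes "mvars f \<subseteq> {1..n}" shows "mvars (to_A n f) \<subseteq> {1..n-1}"
  unfolding to_A_def msubst_def
proof (rule mvars_sum)
  fix m assume m: "m \<in> Poly_Mapping.keys f"
  have "mvars (\<Prod>i\<in>Poly_Mapping.keys m. xA n i ^ Poly_Mapping.lookup m i :: 'a mpoly) \<subseteq> {1..n-1}"
  proof (rule mvars_prod)
    fix i assume "i \<in> Poly_Mapping.keys m"
    then have "i \<in> {1..n}" using m assms by (auto simp: mvars_def)
    then show "mvars (xA n i ^ Poly_Mapping.lookup m i :: 'a mpoly) \<subseteq> {1..n-1}"
      using xA_carrier[of i n] mvars_power by blast
  qed
  then show "mvars (mconst (Poly_Mapping.lookup f m) *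
      (\<Prod>i\<in>Poly_Mapping.keys m. xA n i ^ Poly_Mapping.lookup m i)) \<subseteq> {1..n-1}"
    using mvars_mult[of "mconst (Poly_Mapping.lookup f m)"] by fastforce
qed

abbreviation lin_sum :: "nat \<Rightarrow> 'k::field mpoly" where
  "lin_sum n \<equiv> (\<Sum>i=1..n. mvar i)"

lemma lin_sum_carrier: "mvars (lin_sum n) \<subseteq> {1..n}"
  by (rule mvars_sum) (use mvars_mvar in fastforce)

lemma lin_sum_split: "n > 0 \<Longrightarrow> lin_sum n = mvar n + lin_sum (n - 1)"
  by (cases n) (simp_all add: add.commute)

lemma cong_mod_lin_sum:
  assumes "n > 0" "mvars (f :: 'k::field mpoly) \<subseteq> {1..n}"
  shows "f - to_A n f \<in> PIdl\<^bsub>mpoly_ring {1..n}\<^esub> (lin_sum n)"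
proof -
  let ?R = "mpoly_ring {1..n} :: 'k mpoly ring"
  define J where "J = PIdl\<^bsub>?R\<^esub> (lin_sum n :: 'k mpoly)"
  interpret R: cring ?R by (rule mpoly_ring_cring)
  interpret J: ideal J ?R
    unfolding J_def by (rule R.cgenideal_ideal) (use lin_sum_carrier in simp)
  have mult: "a * b \<in> J" if "a \<in> J" "mvars b \<subseteq> {1..n}" for a b
    using J.I_r_closed[OF that(1), of b] that(2) by simp
  have add: "a + b \<in> J" if "a \<in> J" "b \<in> J" for a b
    using J.a_closed[OF that] by simp
  have zero: "0 \<in> J" using J.zero_closed by simp
  have step: "a * b - a' * b' \<in> J"
    if "a - a' \<in> J" "b - b' \<in> J" "mvars b \<subseteq> {1..n}" "mvars a' \<subseteq> {1..n}" for a b a' b'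
  proof -
    have "a * b - a' * b' = (a - a') * b + (b - b') * a'" by (simp add: algebra_simps)
    then show ?thesis using add mult that by simp
  qed
  have x: "mvar i - xA n i \<in> J" if "i \<in> {1..n}" for i
  proof (cases "i = n")
    case True
    then have "mvar i - xA n i = (lin_sum n :: 'k mpoly)"
      by (simp add: xA_def lin_sum_split[OF assms(1), simplified])
    moreover have "lin_sum n \<in> J"
      unfolding J_def by (rule R.cgenideal_self) (use lin_sum_carrier in simp)
    ultimately show ?thesis by simp
  qed (simp add: xA_def zero)
  have xc: "mvars (xA n i :: 'k mpoly) \<subseteq> {1..n}" if "i \<in> {1..n}" for i
    using xA_carrier[OF that] by fastforce
  have vc: "mvars (mvar i :: 'k mpoly) \<subseteq> {1..n}" if "i \<in> {1..n}" for i
    using mvars_mvar[of i] that by fastforce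
  have pow: "mvar i ^ e - xA n i ^ e \<in> J" if "i \<in> {1..n}" for i e
  proof (induction e)
    case (Suc e)
    have "mvars (mvar i ^ e :: 'k mpoly) \<subseteq> {1..n}" using mvars_power vc[OF that] by blast
    then show ?case using step[OF x[OF that] Suc] xc[OF that] by simp
  qed (simp add: zero)
  have mono: "(\<Prod>i\<in>S. mvar i ^ e i) - (\<Prod>i\<in>S. xA n i ^ e i) \<in> J" if "S \<subseteq> {1..n}" for S e
    using that
  proof (induction S rule: infinite_finite_induct)
    case (insert i S)
    have "mvars (\<Prod>i\<in>S. mvar i ^ e i :: 'k mpoly) \<subseteq> {1..n}"
    proof (rule mvars_prod)
      fix j assume "j \<in> S"
      then show "mvars (mvar j ^ e j :: 'k mpoly) \<subseteq> {1..n}"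
        using mvars_power[of "mvar j" "e j"] vc[of j] insert.prems by blast
    qed
    moreover have "mvars (xA n i ^ e i :: 'k mpoly) \<subseteq> {1..n}"
      using mvars_power[of "xA n i" "e i"] xc[of i] insert.prems by blast
    ultimately show ?case
      using step[OF pow insert.IH] insert by simp
  qed (simp_all add: zero)
  have "msubst mconst mvar f - to_A n f = (\<Sum>m\<in>Poly_Mapping.keys f.
     ((\<Prod>i\<in>Poly_Mapping.keys m. mvar i ^ Poly_Mapping.lookup m i) -
      (\<Prod>i\<in>Poly_Mapping.keys m. xA n i ^ Poly_Mapping.lookup m i)) * mconst (Poly_Mapping.lookup f m))"
    by (simp add: to_A_def msubst_def right_diff_distrib sum_subtractf mult.commute[of _ "mconst _"])
  also have "\<dots> \<in> J"
  proof -
    have sum: "sum h S \<in> J" if "\<And>m. m \<in> S \<Longrightarrow> h m \<in> J"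
      for h :: "(nat \<Rightarrow>\<^sub>0 nat) \<Rightarrow> 'k mpoly" and S
      using that
    proof (induction S rule: infinite_finite_induct)
      case (insert m S)
      then show ?case using add[of "h m" "sum h S"] by simp
    qed (simp_all add: zero)
    show ?thesis
    proof (rule sum)
      fix m assume "m \<in> Poly_Mapping.keys f"
      then have "Poly_Mapping.keys m \<subseteq> {1..n}" using assms(2) by (auto simp: mvars_def)
      then show "((\<Prod>i\<in>Poly_Mapping.keys m. mvar i ^ Poly_Mapping.lookup m i) -
          (\<Prod>i\<in>Poly_Mapping.keys m. xA n i ^ Poly_Mapping.lookup m i)) *
          mconst (Poly_Mapping.lookup f m) \<in> J"
        using mult[OF mono] by simp
    qed
  qed
  finally show ?thesis unfolding J_def by (simp only: msubst_mvar_id)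
qed

lemma to_A_hom: "ring_hom_ring (mpoly_ring {1..n}) (A_ring n) (to_A n :: 'k::field mpoly \<Rightarrow> _)"
proof -
  interpret c: coeff_hom "mconst :: 'k \<Rightarrow> 'k mpoly" by (rule coeff_hom_mconst)
  interpret R: cring "mpoly_ring {1..n} :: 'k mpoly ring" by (rule mpoly_ring_cring)
  interpret S: cring "mpoly_ring {1..n-1} :: 'k mpoly ring" by (rule mpoly_ring_cring)
  show ?thesis
    unfolding A_ring_def
  proof (rule ring_hom_ringI[OF R.ring_axioms S.ring_axioms])
    fix f :: "'k mpoly" assume "f \<in> carrier (mpoly_ring {1..n})"
    then show "to_A n f \<in> carrier (mpoly_ring {1..n-1})"
      using to_A_carrier[of f n] by simp
  qed (simp_all add: to_A_def c.msubst_add c.msubst_mult c.msubst_one)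
qed

lemma to_A_mvar: "to_A n (mvar i) = xA n i"
  by (simp add: to_A_def coeff_hom.msubst_mvar[OF coeff_hom_mconst])

lemma to_A_kernel:
  assumes "n > 0"
  shows "a_kernel (mpoly_ring {1..n}) (A_ring n) (to_A n) = PIdl\<^bsub>mpoly_ring {1..n}\<^esub> (lin_sum n :: 'k::field mpoly)"
proof -
  let ?R = "mpoly_ring {1..n} :: 'k mpoly ring"
  interpret R: cring ?R by (rule mpoly_ring_cring)
  interpret h: ring_hom_ring ?R "A_ring n" "to_A n" by (rule to_A_hom)
  interpret c: coeff_hom "mconst :: 'k \<Rightarrow> 'k mpoly" by (rule coeff_hom_mconst)
  have kernel_iff: "f \<in> a_kernel ?R (A_ring n) (to_A n) \<longleftrightarrow> mvars f \<subseteq> {1..n} \<and> to_A n f = 0" for f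
    unfolding a_kernel_def' A_ring_def mpoly_ring_simps by blast
  have "to_A n (lin_sum n :: 'k mpoly) = 0"
  proof -
    have "to_A n (lin_sum n :: 'k mpoly) = (\<Sum>i=1..n. xA n i)"
      by (simp add: to_A_def c.msubst_sum c.msubst_mvar)
    also have "\<dots> = xA n n + (\<Sum>i=1..n-1. xA n i)"
      using assms by (cases n) (simp_all add: add.commute)
    also have "(\<Sum>i=1..n-1. xA n i :: 'k mpoly) = lin_sum (n - 1)"
      using assms by (intro sum.cong) (auto simp: xA_def)
    finally show ?thesis by (simp add: xA_def)
  qed
  then have "lin_sum n \<in> a_kernel ?R (A_ring n) (to_A n)"
    using lin_sum_carrier unfolding kernel_iff by blast
  then have "PIdl\<^bsub>?R\<^esub> (lin_sum n) \<subseteq> a_kernel ?R (A_ring n) (to_A n)"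
    by (rule R.cgenideal_minimal[OF h.kernel_is_ideal])
  moreover have "f \<in> PIdl\<^bsub>?R\<^esub> (lin_sum n)" if "f \<in> a_kernel ?R (A_ring n) (to_A n)" for f
    using cong_mod_lin_sum[OF assms, of f] that by (simp only: kernel_iff diff_zero)
  ultimately show ?thesis by blast
qed

theorem A_iso_quotient:
  fixes n :: nat
  assumes "n > 0"
  defines "R \<equiv> mpoly_ring {1..n} :: 'k::field mpoly ring"
  defines "J \<equiv> PIdl\<^bsub>R\<^esub> (\<Sum>i=1..n. mvar i)"
  shows "(\<lambda>X. the_elem (to_A n ` X)) \<in> ring_iso (R Quot J) (A_ring n)"
    and "f \<in> carrier R \<Longrightarrow> the_elem (to_A n ` (J +>\<^bsub>R\<^esub> f)) = to_A n f"
    and "i \<in> {1..n} \<Longrightarrow> the_elem (to_A n ` (J +>\<^bsub>R\<^esub> mvar i)) = xA n i"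
proof -
  interpret h: ring_hom_ring R "A_ring n" "to_A n"
    unfolding R_def by (rule to_A_hom)
  have J: "J = a_kernel R (A_ring n) (to_A n)"
    unfolding J_def R_def by (rule to_A_kernel[OF assms(1), symmetric])
  have "carrier (A_ring n :: 'k mpoly ring) \<subseteq> carrier R"
    by (fastforce simp: A_ring_def R_def)
  then have "to_A n ` carrier R = carrier (A_ring n)"
    using to_A_id[OF _ assms(1)] h.hom_closed by (force simp: image_iff)
  then show "(\<lambda>X. the_elem (to_A n ` X)) \<in> ring_iso (R Quot J) (A_ring n)"
    unfolding J by (rule h.FactRing_iso_set)
  show *: "the_elem (to_A n ` (J +>\<^bsub>R\<^esub> f)) = to_A n f" if "f \<in> carrier R" for f
    unfolding J using h.the_elem_simp[OF that] .
  show "the_elem (to_A n ` (J +>\<^bsub>R\<^esub> mvar i)) = xA n i" if "i \<in> {1..n}"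
  proof -
    have "mvars (mvar i :: 'k mpoly) \<subseteq> {i}" by (rule mvars_mvar)
    also have "\<dots> \<subseteq> {1..n}" using that by simp
    finally show ?thesis using *[of "mvar i"] by (simp add: R_def to_A_mvar)
  qed
qed

end

theory Submission
  imports Defs "HOL-Computational_Algebra.Primes"
begin

text \<open>
  Good values of \<open>c\<close> are all those outside the prime field, that is, outside the image of the
  natural numbers in \<open>k\<close>; the prime field has \<open>p\<close> elements. For such \<open>c\<close> the generators
  \<open>f\<^sub>1, \<dots>, f\<^sub>n\<^sub>-\<^sub>1\<close> have no common zero in projective space, so the zero locus has dimension \<open>-1\<close>,
  and they form a minimal set of \<open>n - 1\<close> generators, which is the number needed in \<open>n - 1\<close>
  variables.

  \<^bold>\<open>No common zeros.\<close> Evaluate at a point, let \<open>x\<^sub>1 + \<dots> + x\<^sub>n = 0\<close>, \<open>g = \<Prod>j. (1 - x\<^sub>j z)\<close>, and let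
  \<open>T = \<Sum>m<p. binom c m * (g - 1)\<^sup>m\<close> be the truncation of \<open>g\<^sup>c\<close>, so that \<open>f\<^sub>i = [z\<^sup>p] T / (1 - x\<^sub>i z)\<close>.
  Up to order \<open>z\<^sup>p\<close> the polynomial \<open>T\<close> still satisfies the differential equation \<open>g T' = c g' T\<close> of a
  \<open>c\<close>-th power; here \<open>\<Sum>j. x\<^sub>j = 0\<close> enters, as it makes \<open>g - 1\<close> divisible by \<open>z\<^sup>2\<close>. Since
  \<open>g' / g = - \<Sum>i. x\<^sub>i / (1 - x\<^sub>i z)\<close>, the truncation \<open>Q\<close> of \<open>T\<close> to degree \<open>\<le> p\<close> therefore satisfies
  \<open>Q' = - c \<Sum>i. x\<^sub>i P\<^sub>i\<close>, where \<open>P\<^sub>i\<close> is the truncation of \<open>T / (1 - x\<^sub>i z)\<close> to degree \<open>< p\<close>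
  (\<open>trunc_pow_pderiv\<close>). The coefficient of \<open>z\<^sup>p\<^sup>-\<^sup>1\<close> gives \<open>f\<^sub>1 + \<dots> + f\<^sub>n = 0\<close>, because \<open>p\<close> divides
  \<open>n\<close> (\<open>sum_quot_coeff_eq_0\<close>). So if \<open>f\<^sub>1, \<dots>, f\<^sub>n\<^sub>-\<^sub>1\<close> vanish, then \<open>f\<^sub>n\<close> vanishes too, which means
  that \<open>Q = (1 - x\<^sub>i z) P\<^sub>i\<close> for all \<open>i\<close>, and the equation becomes \<open>g Q' = c g' Q\<close> exactly. Comparing
  lowest terms at a root of \<open>g\<close> of multiplicity \<open>m\<close> shows that \<open>c m\<close> equals, in \<open>k\<close>, the multiplicity of that
  root in \<open>Q\<close> (\<open>multiplicities_proportional\<close>). As \<open>c\<close> is not in the prime field, \<open>p\<close> divides every \<open>m\<close>,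
  hence \<open>g' = 0\<close> and \<open>Q' = 0\<close>. Now \<open>Q = 1 + t z\<^sup>p\<close>, so \<open>x\<^sub>i\<^sup>p = - t\<close> for all \<open>i\<close> and all \<open>x\<^sub>i\<close> are equal,
  say to \<open>b\<close>. Comparing \<open>t = - b\<^sup>p\<close> with \<open>t = c [z\<^sup>p] (1 - b z)\<^sup>n\<close> forces \<open>b = 0\<close>, again because \<open>c\<close> is
  not in the prime field (\<open>only_trivial_common_zero\<close>).

  \<^bold>\<open>Minimality.\<close> All generators are homogeneous of the same degree \<open>p\<close>, so it suffices that they are
  linearly independent over \<open>k\<close> (\<open>genideal_same_degree\<close>). Let \<open>\<Sum>j. a\<^sub>j f\<^sub>j = 0\<close> with
  \<open>a\<^sub>n = 0\<close>. For distinct \<open>i, k < n\<close> compare the values at \<open>e\<^sub>i - e\<^sub>k\<close> and \<open>e\<^sub>n - e\<^sub>k\<close>. Both have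
  \<open>g = 1 - z\<^sup>2\<close>, so only the terms of \<open>f\<^sub>i\<close> and \<open>f\<^sub>n\<close> differ, and \<open>a\<^sub>i\<close> times an alternating sum of
  binomial coefficients is zero. That sum is \<open>\<plusminus> binom (c - 1) K\<close> for some \<open>K < p\<close>, which is nonzero for
  \<open>c\<close> outside the prime field (\<open>f_gen_independent\<close>). No \<open>k\<close> is available if \<open>n = 2\<close>; then the absence of
  common zeros shows that the only generator is nonzero.
\<close>


section \<open>The prime field\<close>

lemma of_nat_nonzero_below_CHAR:
  assumes "CHAR('k::field) = p" "0 < m" "m < p"
  shows "of_nat m \<noteq> (0::'k)"
  using assms by (auto simp: of_nat_eq_0_iff_char_dvd dest: dvd_imp_le)

text \<open>
  The range of \<open>of_nat\<close> is the prime field; it contains quotients because a natural number that is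
  nonzero in \<open>k\<close> is invertible modulo the characteristic.
\<close>

lemma prime_field_division:
  assumes "CHAR('k::field) > 0" "c * of_nat a = (of_nat b :: 'k)" "of_nat a \<noteq> (0 :: 'k)"
  shows "c \<in> range of_nat"
proof -
  let ?p = "CHAR('k)"
  have "prime ?p" using assms(1) by (rule prime_CHAR_semidom)
  moreover have "\<not> ?p dvd a" using assms(3) by (simp add: of_nat_eq_0_iff_char_dvd)
  ultimately have "coprime a ?p" using prime_imp_coprime coprime_commute by blast
  then have "gcd a ?p = 1" by simp
  moreover have "a \<noteq> 0" using assms(3) by (metis of_nat_0)
  ultimately obtain x y where "a * x = ?p * y + 1"
    using bezout_nat[of a ?p] by auto
  then have "of_nat (a * x) = (of_nat (?p * y + 1) :: 'k)" by simp
  then have inv: "of_nat a * of_nat x = (1 :: 'k)" by simp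
  have "c = c * (of_nat a * of_nat x)" by (simp add: inv)
  also have "\<dots> = of_nat (b * x)" using assms(2) by (simp add: mult.assoc[symmetric])
  finally show ?thesis by blast
qed

lemma minus_one_in_prime_field:
  assumes "CHAR('k::field) > 0"
  obtains a where "(-1 :: 'k) = of_nat a"
proof
  have "of_nat (CHAR('k) - 1) + (1 :: 'k) = of_nat (CHAR('k) - 1 + 1)" by (simp only: of_nat_add of_nat_1)
  also have "\<dots> = 0" using assms by simp
  finally show "(-1 :: 'k) = of_nat (CHAR('k) - 1)" by (simp add: add_eq_0_iff minus_equation_iff)
qed

lemma finite_prime_field:
  assumes "CHAR('k::field) > 0"
  shows "finite (range (of_nat :: nat \<Rightarrow> 'k))"
proof -
  have "of_nat m \<in> (of_nat :: nat \<Rightarrow> 'k) ` {..<CHAR('k)}" for m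
  proof
    have "(of_nat m :: 'k) = of_nat (CHAR('k) * (m div CHAR('k)) + m mod CHAR('k))" by simp
    also have "\<dots> = of_nat (m mod CHAR('k))" by (simp only: of_nat_add of_nat_mult of_nat_CHAR) simp
    finally show "of_nat m = (of_nat (m mod CHAR('k)) :: 'k)" .
  qed (use assms in simp)
  then show ?thesis by (meson finite_imageI finite_lessThan finite_subset image_subsetI)
qed


section \<open>Truncated powers and their differential equation\<close>

lemma binom_0 [simp]: "binom c 0 = 1"
  by (simp add: binom_def)

lemma binom_Suc:
  assumes "of_nat (Suc m) \<noteq> (0 :: 'k::field)"
  shows "of_nat (Suc m) * binom c (Suc m) = (c - of_nat m :: 'k) * binom c m"
proof -
  have fact: "of_nat (fact (Suc m)) = (of_nat (Suc m) * of_nat (fact m) :: 'k)"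
    by (simp only: fact_Suc of_nat_mult of_nat_id)
  show ?thesis
    unfolding binom_def fact using assms by (simp del: of_nat_Suc)
qed

text \<open>
  The binomial series of \<open>g\<^sup>c\<close>, cut off after the power \<open>d\<close> of \<open>g - 1\<close>. In characteristic \<open>p\<close> the
  binomial coefficients make sense for \<open>d < p\<close> only.
\<close>

definition trunc_pow :: "'k::field \<Rightarrow> nat \<Rightarrow> 'k poly \<Rightarrow> 'k poly" where
  "trunc_pow c d g = (\<Sum>m\<le>d. smult (binom c m) ((g - 1) ^ m))"

text \<open>
  By the recursion for the binomial coefficients, the terms of \<open>g T' - c g' T\<close> telescope, and only the
  contribution of the cut-off survives, which is of high order in \<open>z\<close> if \<open>g\<close> has constant term \<open>1\<close>.
\<close>

lemma trunc_pow_ode: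
  fixes g :: "'k::field poly"
  assumes "\<And>m. 0 < m \<Longrightarrow> m \<le> d \<Longrightarrow> of_nat m \<noteq> (0 :: 'k)"
  shows "g * pderiv (trunc_pow c d g) - smult c (pderiv g * trunc_pow c d g)
       = smult ((of_nat d - c) * binom c d) (pderiv g * (g - 1) ^ d)"
  using assms
proof (induction d)
  case 0
  show ?case by (simp add: trunc_pow_def)
next
  case (Suc d)
  define T b u where "T = trunc_pow c d g" and "b = binom c (Suc d)" and "u = g - 1"
  have g: "g = 1 + u" and g': "pderiv u = pderiv g" by (simp_all add: u_def pderiv_diff)
  have b: "(c - of_nat d) * binom c d = of_nat (Suc d) * b"
    unfolding b_def by (rule binom_Suc[symmetric]) (use Suc.prems[of "Suc d"] in simp)
  have "trunc_pow c (Suc d) g = T + smult b (u ^ Suc d)"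
    by (simp add: trunc_pow_def T_def b_def u_def)
  then have "g * pderiv (trunc_pow c (Suc d) g) - smult c (pderiv g * trunc_pow c (Suc d) g)
      = (g * pderiv T - smult c (pderiv g * T))
        + smult (of_nat (Suc d) * b) (g * (u ^ d * pderiv g)) - smult (c * b) (pderiv g * u ^ Suc d)"
    by (simp add: pderiv_add pderiv_smult pderiv_power_Suc g' algebra_simps smult_add_right del: power_Suc of_nat_Suc)
  also have "g * pderiv T - smult c (pderiv g * T) = - smult (of_nat (Suc d) * b) (pderiv g * u ^ d)"
    using Suc.IH Suc.prems b by (simp add: T_def u_def flip: smult_minus_left) (simp add: algebra_simps flip: b)
  also have "smult (of_nat (Suc d) * b) (g * (u ^ d * pderiv g))
      = smult (of_nat (Suc d) * b) (pderiv g * u ^ d) + smult (of_nat (Suc d) * b) (pderiv g * u ^ Suc d)"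
    unfolding g by (simp add: algebra_simps smult_add_right pderiv_add)
  finally show ?case
    by (simp add: b_def u_def algebra_simps smult_add_left smult_diff_left)
qed


section \<open>Division by a linear factor\<close>

text \<open>
  The coefficient of \<open>z\<^sup>d\<close> in \<open>f(z) / (1 - y z)\<close>; the value of \<open>f\<^sub>i\<close> at a point has this form.
  Collecting these coefficients below degree \<open>d\<close> gives the truncation \<open>quot_cutoff\<close> of that quotient.
\<close>

definition quot_coeff :: "nat \<Rightarrow> 'k::field poly \<Rightarrow> 'k \<Rightarrow> 'k" where
  "quot_coeff d f y = (\<Sum>l\<le>d. coeff f l * y ^ (d - l))"

definition quot_cutoff :: "nat \<Rightarrow> 'k::field poly \<Rightarrow> 'k \<Rightarrow> 'k poly" where
  "quot_cutoff d f y = (\<Sum>l<d. monom (quot_coeff l f y) l)"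

lemma coeff_quot_cutoff: "coeff (quot_cutoff d f y) l = (if l < d then quot_coeff l f y else 0)"
  by (auto simp: quot_cutoff_def coeff_sum)

lemma quot_coeff_0: "quot_coeff 0 f y = coeff f 0"
  by (simp add: quot_coeff_def)

lemma quot_coeff_Suc: "quot_coeff (Suc d) f y = y * quot_coeff d f y + coeff f (Suc d)"
  by (simp add: quot_coeff_def sum_distrib_left Suc_diff_le mult_ac)

text \<open>
  Division with remainder by \<open>1 - y z\<close>, starting from the constant term: the quotient is a truncation of
  the power series \<open>f(z) / (1 - y z)\<close>, and the first omitted term of that series is the remainder.
\<close>

lemma cutoff_division:
  "poly_cutoff (Suc d) f = [:1, -y:] * quot_cutoff d f y + monom (quot_coeff d f y) d"
proof (rule poly_eqI)
  fix l
  show "coeff (poly_cutoff (Suc d) f) l = coeff ([:1, -y:] * quot_cutoff d f y + monom (quot_coeff d f y) d) l"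
    by (cases l) (auto simp: coeff_poly_cutoff coeff_quot_cutoff quot_coeff_0 quot_coeff_Suc less_Suc_eq)
qed


section \<open>The logarithmic derivative of the truncated power\<close>

lemma monom_dvd_mult_cancel:
  fixes g h :: "'k::field poly"
  assumes "monom 1 d dvd g * h" "coeff g 0 \<noteq> 0"
  shows "monom 1 d dvd h"
proof (cases "h = 0")
  case False
  have g: "g \<noteq> 0" "Polynomial.order 0 g = 0" using assms(2) by (auto intro!: order_0I simp: poly_0_coeff_0)
  then have "Polynomial.order 0 (g * h) = Polynomial.order 0 h" using False by (simp add: order_mult)
  with assms(1) g False show ?thesis by (simp add: monom_1_dvd_iff)
qed simp

definition lin_prod :: "'i set \<Rightarrow> ('i \<Rightarrow> 'k::field) \<Rightarrow> 'k poly" where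
  "lin_prod I x = (\<Prod>i\<in>I. [:1, - x i:])"

lemma coeff_0_lin_prod [simp]: "coeff (lin_prod I x) 0 = 1"
  by (simp add: lin_prod_def poly_prod flip: poly_0_coeff_0)

lemma lin_prod_remove:
  "finite I \<Longrightarrow> i \<in> I \<Longrightarrow> lin_prod I x = [:1, - x i:] * lin_prod (I - {i}) x"
  by (simp add: lin_prod_def prod.remove)

lemma pderiv_lin_prod:
  "pderiv (lin_prod I x) = - (\<Sum>i\<in>I. smult (x i) (lin_prod (I - {i}) x))"
  by (simp add: lin_prod_def pderiv_prod pderiv_pCons sum_negf)

lemma coeff_0_trunc_pow:
  assumes "coeff g 0 = 1"
  shows "coeff (trunc_pow c d g) 0 = 1"
proof -
  have "coeff (trunc_pow c d g) 0 = (\<Sum>m\<le>d. binom c m * 0 ^ m)"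
    using assms by (simp add: trunc_pow_def poly_sum flip: poly_0_coeff_0)
  also have "\<dots> = (\<Sum>m\<in>{0}. binom c m * 0 ^ m)"
    by (rule sum.mono_neutral_right) auto
  finally show ?thesis by simp
qed

text \<open>
  This is \<open>g' / g = - \<Sum>i. x i / (1 - x i * z)\<close> multiplied by \<open>g\<close> and a truncation of \<open>f\<close>, each
  summand being divided by its own linear factor; the last sum collects the remainders.
\<close>

lemma pderiv_lin_prod_mult:
  fixes x :: "'i \<Rightarrow> 'k::field"
  assumes "finite I"
  shows "pderiv (lin_prod I x) * poly_cutoff (Suc d) f
    = - (lin_prod I x * (\<Sum>i\<in>I. smult (x i) (quot_cutoff d f (x i))))
      - (\<Sum>i\<in>I. smult (x i * quot_coeff d f (x i)) (monom 1 d * lin_prod (I - {i}) x))"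
proof -
  have "smult (x i) (lin_prod (I - {i}) x) * poly_cutoff (Suc d) f
      = lin_prod I x * smult (x i) (quot_cutoff d f (x i))
        + smult (x i * quot_coeff d f (x i)) (monom 1 d * lin_prod (I - {i}) x)" if "i \<in> I" for i
  proof -
    have "monom (quot_coeff d f (x i)) d = smult (quot_coeff d f (x i)) (monom 1 d)" by (simp add: smult_monom)
    then show ?thesis
      unfolding cutoff_division[of d f "x i"] lin_prod_remove[OF assms that, of x]
      by (simp add: algebra_simps smult_add_right)
  qed
  then show ?thesis
    by (simp add: pderiv_lin_prod sum_distrib_right sum_distrib_left sum.distrib cong: sum.cong)
qed

text \<open>
  Dividing \<open>g T' = c g' T\<close> by \<open>g\<close> gives the identity modulo \<open>z\<^sup>p\<close>. It is exact because both sides have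
  degree less than \<open>p\<close>: the derivative of \<open>z\<^sup>p\<close> is zero.
\<close>

lemma trunc_pow_pderiv:
  fixes x :: "'i \<Rightarrow> 'k::field" and c :: 'k
  assumes p: "CHAR('k) = p" "p > 0" and I: "finite I" "sum x I = 0"
  defines "g \<equiv> lin_prod I x"
  defines "T \<equiv> trunc_pow c (p - 1) g"
  shows "pderiv (poly_cutoff (Suc p) T) = - smult c (\<Sum>i\<in>I. smult (x i) (quot_cutoff p T (x i)))"
proof -
  let ?z = "\<lambda>d. monom (1 :: 'k) d"
  define Q where "Q = poly_cutoff (Suc p) T"
  have g0: "coeff g 0 = 1" by (simp add: g_def)
  \<comment> \<open>Both \<open>g'\<close> and \<open>g - 1\<close> are divisible by \<open>z\<close>, so the error term of the differential equation
    has order at least \<open>1 + (p - 1) = p\<close>.\<close>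
  have "coeff (pderiv g) 0 = - sum x I"
    by (simp add: g_def pderiv_lin_prod coeff_sum sum_negf)
  then have "?z 1 dvd pderiv g" "?z 1 dvd g - 1"
    using I(2) g0 by (auto simp: monom_1_dvd_iff')
  then have "?z 1 * ?z 1 ^ (p - 1) dvd pderiv g * (g - 1) ^ (p - 1)"
    by (intro mult_dvd_mono dvd_power_same)
  moreover have "?z 1 * ?z 1 ^ (p - 1) = ?z p"
    using p(2) by (simp add: mult_monom flip: power_Suc) (simp add: monom_power)
  moreover have "g * pderiv T - smult c (pderiv g * T)
      = smult ((of_nat (p - 1) - c) * binom c (p - 1)) (pderiv g * (g - 1) ^ (p - 1))"
    unfolding T_def
    by (rule trunc_pow_ode, rule of_nat_nonzero_below_CHAR[OF p(1)]) (use p(2) in auto)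
  ultimately have T: "?z p dvd g * pderiv T - smult c (pderiv g * T)"
    by (simp add: dvd_smult)
  have Q': "?z p dvd pderiv T - pderiv Q" and Q: "?z p dvd T - Q"
    by (auto simp: monom_1_dvd_iff' Q_def coeff_pderiv coeff_poly_cutoff)
  have "g * pderiv Q - smult c (pderiv g * Q) = (g * pderiv T - smult c (pderiv g * T))
      - g * (pderiv T - pderiv Q) + smult c (pderiv g) * (T - Q)"
    by (simp add: algebra_simps smult_diff_right)
  then have cong: "?z p dvd g * pderiv Q - smult c (pderiv g * Q)"
    using T Q Q' by (simp only: dvd_add dvd_diff dvd_mult)
  define S where "S = (\<Sum>i\<in>I. smult (x i) (quot_cutoff p T (x i)))"
  define R where "R = (\<Sum>i\<in>I. smult (x i * quot_coeff p T (x i)) (?z p * lin_prod (I - {i}) x))"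
  have R: "?z p dvd R" unfolding R_def by (intro dvd_sum dvd_smult) simp
  have "pderiv g * Q = - (g * S) - R"
    unfolding Q_def S_def R_def g_def by (rule pderiv_lin_prod_mult[OF I(1)])
  then have "smult c (pderiv g * Q) = - (g * smult c S) - smult c R"
    by (simp add: smult_diff_right)
  then have "g * (pderiv Q + smult c S) = (g * pderiv Q - smult c (pderiv g * Q)) - smult c R"
    by (simp add: algebra_simps)
  then have "?z p dvd g * (pderiv Q + smult c S)"
    using cong R by (simp only: dvd_diff dvd_smult)
  then have low: "?z p dvd pderiv Q + smult c S"
    using g0 by (auto intro: monom_dvd_mult_cancel)
  have "coeff (pderiv Q + smult c S) l = 0" for l
  proof (cases "l < p")
    case True
    then show ?thesis using low unfolding monom_1_dvd_iff' by blast
  next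
    case False
    then show ?thesis by (simp add: coeff_pderiv Q_def coeff_poly_cutoff S_def coeff_sum coeff_quot_cutoff)
  qed
  then have "pderiv Q + smult c S = 0" by (simp add: poly_eq_iff)
  then show "pderiv Q = - smult c S" by (simp add: eq_neg_iff_add_eq_0)
qed

text \<open>
  The coefficient of \<open>z\<^sup>p\<^sup>-\<^sup>1\<close> in the preceding identity: on the left it is \<open>p\<close> times a coefficient,
  and on the right the correction \<open>card I * coeff T p\<close> is zero as well. This is the relation that makes
  one of the generators attached to \<open>x\<^sub>1, \<dots>, x\<^sub>n\<close> superfluous.
\<close>

lemma sum_quot_coeff_eq_0:
  fixes x :: "'i \<Rightarrow> 'k::field" and c :: 'k
  assumes p: "CHAR('k) = p" "p > 0" and I: "finite I" "sum x I = 0" "p dvd card I" and "c \<noteq> 0"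
  shows "(\<Sum>i\<in>I. quot_coeff p (trunc_pow c (p - 1) (lin_prod I x)) (x i)) = 0"
proof -
  define T where "T = trunc_pow c (p - 1) (lin_prod I x)"
  have step: "x i * quot_coeff (p - 1) T (x i) = quot_coeff p T (x i) - coeff T p" for i
    using p(2) quot_coeff_Suc[of "p - 1" T "x i"] by simp
  have "of_nat p = (0 :: 'k)" using p(1) by auto
  then have "0 = coeff (pderiv (poly_cutoff (Suc p) T)) (p - 1)"
    using p(2) by (simp add: coeff_pderiv)
  also have "pderiv (poly_cutoff (Suc p) T) = - smult c (\<Sum>i\<in>I. smult (x i) (quot_cutoff p T (x i)))"
    unfolding T_def by (rule trunc_pow_pderiv[OF p I(1,2)])
  also have "coeff \<dots> (p - 1) = - (c * (\<Sum>i\<in>I. x i * quot_coeff (p - 1) T (x i)))"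
    using p(2) by (simp add: coeff_sum coeff_quot_cutoff)
  also have "(\<Sum>i\<in>I. x i * quot_coeff (p - 1) T (x i))
      = (\<Sum>i\<in>I. quot_coeff p T (x i)) - of_nat (card I) * coeff T p"
    unfolding step by (simp add: sum_subtractf)
  also have "of_nat (card I) = (0 :: 'k)"
    using I(3) p(1) by (simp add: of_nat_eq_0_iff_char_dvd)
  finally show ?thesis using \<open>c \<noteq> 0\<close> by (simp add: T_def)
qed


section \<open>Common zeros of the generators\<close>

text \<open>
  A differential equation \<open>Q' / Q = c g' / g\<close> says that the residues of \<open>Q' / Q\<close>, which are
  multiplicities of roots, are \<open>c\<close> times those of \<open>g' / g\<close>. Only the residues as elements of \<open>k\<close>
  are visible, so the multiplicities are compared modulo the characteristic.
\<close>

lemma multiplicities_proportional: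
  fixes g Q v :: "'k::field poly"
  assumes ode: "g * pderiv Q = smult c (pderiv g * Q)"
    and g: "g = [:- a, 1:] ^ m * v" "poly v a \<noteq> 0" and "Q \<noteq> 0"
  shows "of_nat (Polynomial.order a Q) = c * of_nat m"
proof -
  define w s where "w = [:- a, 1:]" and "s = Polynomial.order a Q"
  obtain u where u: "Q = w ^ s * u" "\<not> w dvd u"
    using order_decomp[OF \<open>Q \<noteq> 0\<close>, of a] by (auto simp: w_def s_def)
  have w: "pderiv w = 1" "w \<noteq> 0" "poly w a = 0" by (simp_all add: w_def pderiv_pCons)
  have ua: "poly u a \<noteq> 0" using u(2) by (simp add: w_def poly_eq_0_iff_dvd)
  \<comment> \<open>The additional factor \<open>w\<close> keeps the exponents of \<open>w\<close> from dropping below zero when \<open>e = 0\<close>.\<close>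
  have deriv: "w * pderiv (w ^ e * h) = w ^ e * (smult (of_nat e) h + w * pderiv h)" for e h
  proof (cases e)
    case (Suc n)
    show ?thesis
      unfolding Suc pderiv_mult pderiv_power_Suc w(1) by (simp add: algebra_simps del: of_nat_Suc)
  qed simp
  have gw: "g = w ^ m * v" using g(1) by (simp add: w_def)
  have "w ^ (m + s) * (v * (smult (of_nat s) u + w * pderiv u)) = g * (w * pderiv Q)"
    unfolding u(1) deriv gw by (simp add: power_add mult_ac)
  also have "\<dots> = smult c (w * pderiv g * Q)"
    using arg_cong[OF ode, of "(*) w"] by (simp add: mult_ac)
  also have "\<dots> = w ^ (m + s) * smult c ((smult (of_nat m) v + w * pderiv v) * u)"
    unfolding gw deriv u(1) by (simp add: power_add mult_ac)
  finally have "v * (smult (of_nat s) u + w * pderiv u) = smult c ((smult (of_nat m) v + w * pderiv v) * u)"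
    using w(2) by (metis mult_left_cancel power_not_zero)
  then have "poly (v * (smult (of_nat s) u + w * pderiv u)) a
      = poly (smult c ((smult (of_nat m) v + w * pderiv v) * u)) a" by simp
  then have "of_nat s * (poly v a * poly u a) = c * of_nat m * (poly v a * poly u a)"
    by (simp add: w(3) mult_ac)
  with ua g(2) show ?thesis by (simp add: s_def)
qed

lemma lin_prod_group:
  assumes "finite I"
  shows "lin_prod I x = (\<Prod>y\<in>x ` I. [:1, - y:] ^ card {i \<in> I. x i = y})"
proof -
  have "lin_prod I x = (\<Prod>y\<in>x ` I. \<Prod>i\<in>{i \<in> I. x i = y}. [:1, - x i:])"
    unfolding lin_prod_def by (rule prod.image_gen[OF assms])
  also have "\<dots> = (\<Prod>y\<in>x ` I. \<Prod>i\<in>{i \<in> I. x i = y}. [:1, - y:])"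
    by (intro prod.cong) auto
  finally show ?thesis by simp
qed

text \<open>
  If \<open>c * of_nat m\<close> is a natural number in \<open>k\<close> and \<open>c\<close> is not in the prime field, then \<open>m\<close> is zero in
  \<open>k\<close>. So all nonzero \<open>x i\<close> are repeated a multiple of \<open>p\<close> times and \<open>lin_prod I x\<close> is a
  product of \<open>p\<close>-th powers.
\<close>

lemma pderiv_lin_prod_eq_0:
  fixes x :: "'i \<Rightarrow> 'k::field"
  assumes "CHAR('k) > 0" "finite I" "c \<notin> range of_nat" "Q \<noteq> 0"
    and ode: "lin_prod I x * pderiv Q = smult c (pderiv (lin_prod I x) * Q)"
  shows "pderiv (lin_prod I x) = 0"
proof -
  let ?m = "\<lambda>y. card {i \<in> I. x i = y}"
  have "pderiv ([:1, - y:] ^ ?m y) = 0" if y: "y \<in> x ` I" for y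
  proof (cases "y = 0")
    case False
    define v where "v = (\<Prod>y'\<in>x ` I - {y}. [:1, - y':] ^ ?m y')"
    have "[:1, - y:] = smult (- y) [:- (1 / y), 1:]" using False by simp
    then have "[:1, - y:] ^ ?m y = smult ((- y) ^ ?m y) ([:- (1 / y), 1:] ^ ?m y)"
      by (simp only: smult_power)
    moreover have "lin_prod I x = [:1, - y:] ^ ?m y * v"
      unfolding lin_prod_group[OF assms(2)] v_def using y assms(2) by (simp add: prod.remove)
    ultimately have "lin_prod I x = [:- (1 / y), 1:] ^ ?m y * smult ((- y) ^ ?m y) v"
      by simp
    moreover have "poly (smult ((- y) ^ ?m y) v) (1 / y) \<noteq> 0"
      using False assms(2) by (auto simp: v_def poly_prod)
    ultimately have "of_nat (Polynomial.order (1 / y) Q) = c * of_nat (?m y)"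
      by (rule multiplicities_proportional[OF ode _ _ \<open>Q \<noteq> 0\<close>])
    then have "of_nat (?m y) = (0 :: 'k)"
      using prime_field_division[OF assms(1), of c "?m y" "Polynomial.order (1 / y) Q"] assms(3) by auto
    then show ?thesis by (simp add: pderiv_power)
  qed (simp add: pCons_one flip: one_pCons)
  then show ?thesis
    by (simp add: lin_prod_group[OF assms(2)] pderiv_prod)
qed

text \<open>
  From \<open>(g - 1)\<^sup>2\<close> on, the terms of the binomial series have order at least \<open>2 d\<close>.
\<close>

lemma coeff_trunc_pow:
  fixes g :: "'k::field poly"
  assumes "monom 1 d dvd g - 1" "d > 0" "e > 0"
  shows "coeff (trunc_pow c e g) d = c * coeff g d"
proof -
  have "coeff ((g - 1) ^ m) d = 0" if "m \<ge> 2" for m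
  proof -
    have "monom (1 :: 'k) (2 * d) = monom 1 d ^ 2" by (simp add: monom_power mult.commute)
    also have "\<dots> dvd (g - 1) ^ 2" by (rule dvd_power_same[OF assms(1)])
    also have "\<dots> dvd (g - 1) ^ m" by (rule le_imp_power_dvd[OF that])
    finally have "\<forall>k<2 * d. coeff ((g - 1) ^ m) k = 0" unfolding monom_1_dvd_iff' .
    then show ?thesis using assms(2) by simp
  qed
  then have high: "binom c m * coeff ((g - 1) ^ m) d = 0" if "m \<in> {..e} - {1}" for m
    using that assms(2) by (cases "m = 0") (auto simp: coeff_1)
  have "coeff (trunc_pow c e g) d = (\<Sum>m\<le>e. binom c m * coeff ((g - 1) ^ m) d)"
    by (simp only: trunc_pow_def coeff_sum coeff_smult)
  also have "\<dots> = (\<Sum>m\<in>{1}. binom c m * coeff ((g - 1) ^ m) d)"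
    using assms(3) high by (intro sum.mono_neutral_right ballI) auto
  also have "\<dots> = c * coeff g d"
    using assms(2) by (simp add: binom_def coeff_1)
  finally show ?thesis .
qed

lemma quot_coeff_eqI:
  assumes "coeff f 0 = 1" "d > 0" "\<And>l. 0 < l \<Longrightarrow> l < d \<Longrightarrow> coeff f l = 0"
  shows "quot_coeff d f y = y ^ d + coeff f d"
proof -
  have "quot_coeff d f y = (\<Sum>l\<in>{0, d}. coeff f l * y ^ (d - l))"
    unfolding quot_coeff_def by (rule sum.mono_neutral_right) (use assms(3) in auto)
  with assms(1,2) show ?thesis by simp
qed

text \<open>
  The index \<open>j\<close> is the one without generator; for the ideal \<open>I\<^sub>c\<close> it is \<open>n\<close>.
\<close>

lemma only_trivial_common_zero:
  fixes x :: "'i \<Rightarrow> 'k::field" and c :: 'k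
  assumes p: "CHAR('k) = p" "p > 0" and I: "finite I" "sum x I = 0" "p dvd card I"
    and c: "c \<notin> range of_nat"
    and j: "j \<in> I" "\<And>i. i \<in> I - {j} \<Longrightarrow> quot_coeff p (trunc_pow c (p - 1) (lin_prod I x)) (x i) = 0"
    and i: "i \<in> I"
  shows "x i = 0"
proof -
  have prime: "prime p" using p prime_CHAR_semidom[where ?'a = 'k] by simp
  have "c \<noteq> 0" using c by (metis of_nat_0 rangeI)
  define g where "g = lin_prod I x"
  define T where "T = trunc_pow c (p - 1) g"
  define Q where "Q = poly_cutoff (Suc p) T"
  have T0: "coeff T 0 = 1" unfolding T_def by (rule coeff_0_trunc_pow) (simp add: g_def)
  have vanish: "quot_coeff p T (x i) = 0" if "i \<in> I" for i
  proof (cases "i = j")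
    case True
    have "(\<Sum>i\<in>I. quot_coeff p T (x i)) = 0"
      unfolding T_def g_def by (rule sum_quot_coeff_eq_0[OF p I \<open>c \<noteq> 0\<close>])
    then have "quot_coeff p T (x j) + (\<Sum>i\<in>I - {j}. quot_coeff p T (x i)) = 0"
      using I(1) j(1) by (simp add: sum.remove)
    with True j(2) show ?thesis by (simp add: T_def g_def)
  qed (use j(2) that in \<open>auto simp: T_def g_def\<close>)
  have "pderiv g * Q = - (g * (\<Sum>i\<in>I. smult (x i) (quot_cutoff p T (x i))))"
    unfolding g_def Q_def by (subst pderiv_lin_prod_mult[OF I(1)]) (simp add: vanish)
  moreover have "pderiv Q = - smult c (\<Sum>i\<in>I. smult (x i) (quot_cutoff p T (x i)))"
    unfolding Q_def T_def g_def by (rule trunc_pow_pderiv[OF p I(1,2)])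
  ultimately have ode: "g * pderiv Q = smult c (pderiv g * Q)" by simp
  have "Q \<noteq> 0" using T0 by (auto simp: Q_def poly_eq_iff coeff_poly_cutoff intro!: exI[of _ 0])
  then have g': "pderiv g = 0"
    unfolding g_def using p I(1) c ode[unfolded g_def] by (intro pderiv_lin_prod_eq_0) auto
  have "g \<noteq> 0" by (auto simp: g_def poly_eq_iff intro!: exI[of _ 0])
  with ode g' have Q': "pderiv Q = 0" by simp
  have low: "coeff f l = 0" if "pderiv f = 0" "0 < l" "l < p" for f :: "'k poly" and l
  proof -
    have "of_nat l * coeff f l = coeff (pderiv f) (l - 1)" using that(2) by (simp add: coeff_pderiv)
    with that of_nat_nonzero_below_CHAR[OF p(1) that(2,3)] show ?thesis by simp
  qed
  have "coeff T l = 0" if "0 < l" "l < p" for l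
    using low[OF Q' that] that by (simp add: Q_def coeff_poly_cutoff)
  then have root: "x i ^ p + coeff T p = 0" if "i \<in> I" for i
    using quot_coeff_eqI[OF T0 p(2), of "x i"] vanish[OF that] by simp
  \<comment> \<open>Frobenius is injective, so the equations just obtained leave only one value for all \<open>x i\<close>.\<close>
  define b where "b = x j"
  have x_eq: "x i = b" if "i \<in> I" for i
  proof -
    have "(x i - b) ^ p = x i ^ p - b ^ p"
      using freshmans_dream[of p "x i - b" b, OF _ p(1)[symmetric]] prime unfolding p(1) by simp
    also have "\<dots> = (x i ^ p + coeff T p) - (x j ^ p + coeff T p)" by (simp add: b_def)
    also have "\<dots> = 0" by (simp only: root[OF that] root[OF j(1)] diff_self)
    finally show ?thesis by simp
  qed
  have g: "g = [:1, - b:] ^ card I"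
    unfolding g_def lin_prod_def using x_eq by (simp cong: prod.cong)
  have "monom 1 p dvd g - 1"
    unfolding monom_1_dvd_iff' using low[OF g'] by (auto simp: coeff_1 g_def)
  then have "coeff T p = c * coeff g p"
    unfolding T_def using prime_gt_1_nat[OF prime] by (intro coeff_trunc_pow) auto
  also have "coeff g p = of_nat (card I choose p) * (-1) ^ p * b ^ p"
  proof -
    have "p \<le> card I" using I(1,3) i by (intro dvd_imp_le) (auto simp: card_gt_0_iff)
    then show ?thesis unfolding g by (simp add: coeff_linear_poly_power power_minus[of b])
  qed
  finally have "b ^ p + c * (of_nat (card I choose p) * (-1) ^ p * b ^ p) = 0"
    using root[OF j(1)] by (simp only: b_def)
  then have eq: "b ^ p * (c * (of_nat (card I choose p) * (-1) ^ Suc p) - 1) = 0"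
    by (simp add: algebra_simps add_eq_0_iff)
  show ?thesis
  proof (rule ccontr)
    assume "x i \<noteq> 0"
    then have "b \<noteq> 0" using x_eq[OF i] by simp
    with eq have unit: "c * (of_nat (card I choose p) * (-1) ^ Suc p) = 1" by simp
    obtain a where "(-1 :: 'k) = of_nat a" using minus_one_in_prime_field p by metis
    then have "c * of_nat ((card I choose p) * a ^ Suc p) = of_nat 1"
      using unit by (simp only: of_nat_mult of_nat_power of_nat_1)
    moreover from this have "of_nat ((card I choose p) * a ^ Suc p) \<noteq> (0 :: 'k)" by auto
    ultimately show False using prime_field_division[of c] p c by blast
  qed
qed


section \<open>Alternating sums of binomial coefficients\<close>

lemma binom_Pascal:
  assumes "of_nat (Suc d) \<noteq> (0 :: 'k::field)"
  shows "binom c (Suc d) - binom (c - 1) (Suc d) = binom (c - 1 :: 'k) d"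
proof -
  define q where "q = (\<Prod>i<d. c - 1 - of_nat i)"
  have "(\<Prod>i<Suc d. c - of_nat i) = c * q"
    unfolding prod.lessThan_Suc_shift q_def by (simp add: diff_diff_eq)
  moreover have "(\<Prod>i<Suc d. c - 1 - of_nat i) = q * (c - of_nat (Suc d))"
    by (simp add: q_def diff_diff_eq)
  moreover have "of_nat (fact (Suc d)) = (of_nat (Suc d) * of_nat (fact d) :: 'k)"
    by (simp only: fact_Suc of_nat_mult of_nat_id)
  ultimately have "binom c (Suc d) - binom (c - 1) (Suc d)
      = (c * q - q * (c - of_nat (Suc d))) / (of_nat (Suc d) * of_nat (fact d))"
    unfolding binom_def by (simp only: diff_divide_distrib)
  also have "c * q - q * (c - of_nat (Suc d)) = of_nat (Suc d) * q"
    by (simp add: algebra_simps)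
  finally show ?thesis
    using assms by (simp add: binom_def q_def del: of_nat_Suc)
qed

lemma sum_alternating_binom:
  fixes c :: "'k::field"
  assumes "\<And>m. 0 < m \<Longrightarrow> m \<le> d \<Longrightarrow> of_nat m \<noteq> (0 :: 'k)"
  shows "(\<Sum>m\<le>d. (-1) ^ m * binom c m) = (-1) ^ d * binom (c - 1) d"
  using assms
proof (induction d)
  case (Suc d)
  have "of_nat (Suc d) \<noteq> (0 :: 'k)" using Suc.prems[of "Suc d"] by simp
  then have "binom c (Suc d) = binom (c - 1) (Suc d) + binom (c - 1) d"
    using binom_Pascal[of d c] by (simp add: algebra_simps)
  moreover have "(\<Sum>m\<le>d. (-1) ^ m * binom c m) = (-1) ^ d * binom (c - 1) d"
    using Suc by simp
  ultimately show ?case by (simp add: algebra_simps)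
qed simp


section \<open>Values of the generators\<close>

lemma fps_right_inverse_lin_fps:
  "fps_right_inverse (lin_fps a) 1 = Abs_fps (\<lambda>l. (a :: 'k::field mpoly) ^ l)" (is "?inv = ?G")
proof -
  have G: "lin_fps a * ?G = 1"
  proof (rule fps_ext)
    fix l
    have "lin_fps a * ?G = ?G - fps_const a * (fps_X * ?G)" by (simp add: lin_fps_def algebra_simps)
    then show "fps_nth (lin_fps a * ?G) l = fps_nth 1 l" by (cases l) simp_all
  qed
  have "lin_fps a * ?inv = 1" by (rule fps_right_inverse) (simp add: lin_fps_def)
  then have "?inv * lin_fps a = 1" by (simp only: mult.commute)
  then have "?inv * lin_fps a * ?G = ?G" by (simp only: mult_1_left)
  then show ?thesis by (simp only: mult.assoc G mult_1_right)
qed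

definition trunc_pow_fps :: "nat \<Rightarrow> nat \<Rightarrow> 'k::field \<Rightarrow> 'k mpoly fps" where
  "trunc_pow_fps p n c =
     (\<Sum>m=0..p-1. fps_const (mconst (binom c m)) * ((\<Prod>j=1..n. lin_fps (xA n j)) - 1) ^ m)"

lemma f_gen_eq:
  "f_gen p n c i = (\<Sum>l\<le>p. fps_nth (trunc_pow_fps p n c) l * xA n i ^ (p - l))"
  unfolding f_gen_def F_fps_def trunc_pow_fps_def[symmetric] fps_right_inverse_lin_fps
  by (subst mult.commute) (simp add: fps_mult_nth atLeast0AtMost)

interpretation meval: coeff_hom "\<lambda>a::'k::field. a"
  by (rule coeff_hom_id)

lemma meval_power: "meval x (f ^ e) = meval x f ^ e"
  by (induction e) (simp_all add: meval.msubst_one meval.msubst_mult)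

lemma meval_diff: "meval x (f - g) = meval x f - meval x g"
  using meval.msubst_add[of x "f - g" g] by simp

lemma meval_mconst: "meval x (mconst a) = a"
  by (simp add: mconst_def meval.msubst_single)

text \<open>
  Evaluation at \<open>x\<close> sends \<open>A[[z]]\<close> to \<open>k[[z]]\<close>; the series of interest go to polynomials,
  where derivatives and multiplicities of roots are available.
\<close>

definition evaluates_to :: "(nat \<Rightarrow> 'k::field) \<Rightarrow> 'k mpoly fps \<Rightarrow> 'k poly \<Rightarrow> bool" where
  "evaluates_to x F q \<longleftrightarrow> (\<forall>l. meval x (fps_nth F l) = coeff q l)"

lemma evaluates_to_mult:
  "evaluates_to x F q \<Longrightarrow> evaluates_to x G r \<Longrightarrow> evaluates_to x (F * G) (q * r)"
  by (simp add: evaluates_to_def fps_mult_nth coeff_mult meval.msubst_sum meval.msubst_mult atLeast0AtMost)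

lemma evaluates_to_diff:
  "evaluates_to x F q \<Longrightarrow> evaluates_to x G r \<Longrightarrow> evaluates_to x (F - G) (q - r)"
  by (simp add: evaluates_to_def meval_diff)

lemma evaluates_to_const: "evaluates_to x (fps_const (mconst a)) [:a:]"
  by (auto simp: evaluates_to_def meval_mconst meval.msubst_zero coeff_pCons split: nat.split)

lemma evaluates_to_one: "evaluates_to x 1 1"
  by (simp add: evaluates_to_def meval.msubst_zero meval.msubst_one coeff_1)

lemma evaluates_to_sum:
  "(\<And>a. a \<in> S \<Longrightarrow> evaluates_to x (F a) (q a)) \<Longrightarrow> evaluates_to x (sum F S) (sum q S)"
  by (simp add: evaluates_to_def fps_sum_nth coeff_sum meval.msubst_sum)

lemma evaluates_to_power: "evaluates_to x F q \<Longrightarrow> evaluates_to x (F ^ e) (q ^ e)"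
  by (induction e) (simp_all add: evaluates_to_one evaluates_to_mult)

lemma evaluates_to_prod:
  "(\<And>a. a \<in> S \<Longrightarrow> evaluates_to x (F a) (q a)) \<Longrightarrow> evaluates_to x (prod F S) (prod q S)"
  by (induction S rule: infinite_finite_induct) (simp_all add: evaluates_to_one evaluates_to_mult)

lemma evaluates_to_lin_fps: "evaluates_to x (lin_fps a) [:1, - meval x a:]"
  by (auto simp: evaluates_to_def lin_fps_def meval.msubst_one meval.msubst_zero meval.msubst_uminus
      coeff_pCons fps_X_def split: nat.split)

text \<open>
  A point of the space with coordinates \<open>x\<^sub>1, \<dots>, x\<^sub>n\<^sub>-\<^sub>1\<close>, seen on the hyperplane
  \<open>x\<^sub>1 + \<dots> + x\<^sub>n = 0\<close>: these are the values of the classes \<open>xA n i\<close>.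
\<close>

definition sum_zero_point :: "nat \<Rightarrow> (nat \<Rightarrow> 'k::field) \<Rightarrow> nat \<Rightarrow> 'k" where
  "sum_zero_point n x i = (if i = n then - (\<Sum>j=1..n-1. x j) else x i)"

lemma meval_xA: "meval x (xA n i) = sum_zero_point n x i"
  by (simp add: xA_def sum_zero_point_def meval.msubst_uminus meval.msubst_sum meval.msubst_mvar)

lemma sum_sum_zero_point:
  assumes "n > 0"
  shows "sum (sum_zero_point n x) {1..n} = 0"
proof -
  have "{1..n} = insert n {1..n-1}" using assms by auto
  then have "sum (sum_zero_point n x) {1..n}
      = sum_zero_point n x n + sum (sum_zero_point n x) {1..n-1}"
    using assms by simp
  also have "sum (sum_zero_point n x) {1..n-1} = (\<Sum>j=1..n-1. x j)"
    using assms by (intro sum.cong) (auto simp: sum_zero_point_def)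
  finally show ?thesis by (simp add: sum_zero_point_def)
qed

lemma meval_f_gen:
  "meval x (f_gen p n c i) = quot_coeff p (trunc_pow c (p - 1) (lin_prod {1..n} (sum_zero_point n x)))
     (sum_zero_point n x i)"
proof -
  have "evaluates_to x (trunc_pow_fps p n c) (\<Sum>m=0..p-1. [:binom c m:] *
      ((\<Prod>j=1..n. [:1, - meval x (xA n j):]) - 1) ^ m)"
    unfolding trunc_pow_fps_def
    by (intro evaluates_to_sum evaluates_to_mult evaluates_to_const evaluates_to_power
        evaluates_to_diff evaluates_to_prod evaluates_to_lin_fps evaluates_to_one)
  then have "evaluates_to x (trunc_pow_fps p n c)
      (trunc_pow c (p - 1) (lin_prod {1..n} (sum_zero_point n x)))"
    by (simp add: trunc_pow_def lin_prod_def meval_xA atLeast0AtMost)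
  then show ?thesis
    by (simp add: f_gen_eq meval.msubst_sum meval.msubst_mult meval_power meval_xA evaluates_to_def quot_coeff_def)
qed


section \<open>Homogeneity of the generators\<close>

lemma homogeneous_zero: "homogeneous d 0"
  by (simp add: homogeneous_def)

lemma homogeneous_one: "homogeneous 0 1"
  by (simp add: homogeneous_def)

lemma homogeneous_mconst: "homogeneous 0 (mconst a)"
  by (auto simp: homogeneous_def mconst_def split: if_splits)

lemma homogeneous_mvar: "homogeneous 1 (mvar i :: 'k::field mpoly)"
  by (auto simp: homogeneous_def mvar_def split: if_splits)

lemma homogeneous_add: "homogeneous d f \<Longrightarrow> homogeneous d g \<Longrightarrow> homogeneous d (f + g)"
  using Poly_Mapping.keys_add[of f g] by (auto simp: homogeneous_def)

lemma homogeneous_uminus: "homogeneous d f \<Longrightarrow> homogeneous d (- f)"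
  by (auto simp: homogeneous_def in_keys_iff)

lemma homogeneous_sum: "(\<And>a. a \<in> S \<Longrightarrow> homogeneous d (h a)) \<Longrightarrow> homogeneous d (sum h S)"
  by (induction S rule: infinite_finite_induct) (auto simp: homogeneous_zero homogeneous_add)

lemma degree_monomial_add:
  fixes a b :: "nat \<Rightarrow>\<^sub>0 nat"
  shows "(\<Sum>i\<in>Poly_Mapping.keys (a + b). Poly_Mapping.lookup (a + b) i)
    = (\<Sum>i\<in>Poly_Mapping.keys a. Poly_Mapping.lookup a i) + (\<Sum>i\<in>Poly_Mapping.keys b. Poly_Mapping.lookup b i)"
proof -
  let ?S = "Poly_Mapping.keys a \<union> Poly_Mapping.keys b"
  have deg: "(\<Sum>i\<in>Poly_Mapping.keys m. Poly_Mapping.lookup m i) = (\<Sum>i\<in>?S. Poly_Mapping.lookup m i)"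
    if "Poly_Mapping.keys m \<subseteq> ?S" for m
    by (rule sum.mono_neutral_left) (use that in \<open>auto simp: in_keys_iff\<close>)
  have "(\<Sum>i\<in>Poly_Mapping.keys (a + b). Poly_Mapping.lookup (a + b) i)
      = (\<Sum>i\<in>?S. Poly_Mapping.lookup (a + b) i)"
    by (rule deg, rule Poly_Mapping.keys_add)
  then show ?thesis
    by (simp add: deg[of a] deg[of b] lookup_add sum.distrib)
qed

lemma homogeneous_mult:
  assumes "homogeneous d f" "homogeneous e g"
  shows "homogeneous (d + e) (f * g)"
  unfolding homogeneous_def
proof
  fix m assume "m \<in> Poly_Mapping.keys (f * g)"
  then obtain a b where "a \<in> Poly_Mapping.keys f" "b \<in> Poly_Mapping.keys g" "m = a + b"
    using keys_mult[of f g] by blast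
  with assms show "(\<Sum>i\<in>Poly_Mapping.keys m. Poly_Mapping.lookup m i) = d + e"
    by (simp add: homogeneous_def degree_monomial_add)
qed

lemma homogeneous_power: "homogeneous d f \<Longrightarrow> homogeneous (e * d) (f ^ e)"
  by (induction e) (simp_all add: homogeneous_one homogeneous_mult)

text \<open>
  Homogeneous elements of degree zero, when \<open>z\<close> gets degree \<open>-1\<close>; they form a ring, to which all
  series in the definition of \<open>f_gen\<close> belong.
\<close>

definition graded_fps :: "nat set \<Rightarrow> 'k::field mpoly fps \<Rightarrow> bool" where
  "graded_fps V F \<longleftrightarrow> (\<forall>l. homogeneous l (fps_nth F l) \<and> mvars (fps_nth F l) \<subseteq> V)"

lemma graded_fps_mult:
  assumes "graded_fps V F" "graded_fps V G"
  shows "graded_fps V (F * G)"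
  unfolding graded_fps_def fps_mult_nth
proof (intro allI conjI homogeneous_sum mvars_sum)
  fix l i :: nat assume "i \<in> {0..l}"
  then show "homogeneous l (fps_nth F i * fps_nth G (l - i))"
    using assms homogeneous_mult[of i "fps_nth F i" "l - i" "fps_nth G (l - i)"] by (simp add: graded_fps_def)
  have "mvars (fps_nth F i) \<union> mvars (fps_nth G (l - i)) \<subseteq> V"
    using assms by (simp add: graded_fps_def)
  with mvars_mult show "mvars (fps_nth F i * fps_nth G (l - i)) \<subseteq> V" by (rule order_trans)
qed

lemma graded_fps_const: "graded_fps V (fps_const (mconst a))"
  by (auto simp: graded_fps_def homogeneous_zero homogeneous_mconst)

lemma graded_fps_one: "graded_fps V 1"
  by (auto simp: graded_fps_def homogeneous_zero homogeneous_one)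

lemma graded_fps_sum: "(\<And>a. a \<in> S \<Longrightarrow> graded_fps V (F a)) \<Longrightarrow> graded_fps V (sum F S)"
  unfolding graded_fps_def fps_sum_nth by (intro allI conjI homogeneous_sum mvars_sum) blast+

lemma graded_fps_diff: "graded_fps V F \<Longrightarrow> graded_fps V G \<Longrightarrow> graded_fps V (F - G)"
  unfolding graded_fps_def fps_sub_nth
proof (intro allI conjI)
  fix l
  assume F: "\<forall>l. homogeneous l (fps_nth F l) \<and> mvars (fps_nth F l) \<subseteq> V"
    and G: "\<forall>l. homogeneous l (fps_nth G l) \<and> mvars (fps_nth G l) \<subseteq> V"
  have diff: "fps_nth F l - fps_nth G l = fps_nth F l + - fps_nth G l" by simp
  show "homogeneous l (fps_nth F l - fps_nth G l)"
    unfolding diff using F G by (intro homogeneous_add homogeneous_uminus) blast+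
  have "mvars (fps_nth F l - fps_nth G l) \<subseteq> mvars (fps_nth F l) \<union> mvars (- fps_nth G l)"
    unfolding diff by (rule mvars_add)
  also have "\<dots> \<subseteq> V" using F G by simp
  finally show "mvars (fps_nth F l - fps_nth G l) \<subseteq> V" .
qed

lemma graded_fps_power: "graded_fps V F \<Longrightarrow> graded_fps V (F ^ e)"
  by (induction e) (simp_all add: graded_fps_one graded_fps_mult)

lemma graded_fps_prod: "(\<And>a. a \<in> S \<Longrightarrow> graded_fps V (F a)) \<Longrightarrow> graded_fps V (prod F S)"
  by (induction S rule: infinite_finite_induct) (simp_all add: graded_fps_one graded_fps_mult)

lemma graded_fps_lin_fps:
  assumes "homogeneous 1 a" "mvars a \<subseteq> V"
  shows "graded_fps V (lin_fps a)"
proof -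
  have "fps_nth (lin_fps a) l = (if l = 0 then 1 else if l = 1 then - a else 0)" for l
    by (simp add: lin_fps_def fps_X_def)
  with assms show ?thesis
    by (simp add: graded_fps_def homogeneous_zero homogeneous_one homogeneous_uminus)
qed

lemma homogeneous_xA: "homogeneous 1 (xA n i)"
  unfolding xA_def by (auto intro!: homogeneous_uminus homogeneous_sum homogeneous_mvar simp del: One_nat_def)

lemma f_gen_graded:
  assumes "i \<in> {1..n}"
  shows "homogeneous p (f_gen p n c i)" and "mvars (f_gen p n c i) \<subseteq> {1..n-1}"
proof -
  let ?V = "{1..n-1}"
  have T: "graded_fps ?V (trunc_pow_fps p n c)"
    unfolding trunc_pow_fps_def
    by (intro graded_fps_sum graded_fps_mult graded_fps_const graded_fps_power graded_fps_diff
        graded_fps_prod graded_fps_lin_fps homogeneous_xA xA_carrier graded_fps_one)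
  show "homogeneous p (f_gen p n c i)"
    unfolding f_gen_eq
  proof (rule homogeneous_sum)
    fix l assume "l \<in> {..p}"
    have "homogeneous (l + (p - l) * 1) (fps_nth (trunc_pow_fps p n c) l * xA n i ^ (p - l))"
      by (intro homogeneous_mult homogeneous_power homogeneous_xA) (use T in \<open>simp add: graded_fps_def\<close>)
    with \<open>l \<in> {..p}\<close> show "homogeneous p (fps_nth (trunc_pow_fps p n c) l * xA n i ^ (p - l))"
      by simp
  qed
  show "mvars (f_gen p n c i) \<subseteq> ?V"
    unfolding f_gen_eq
  proof (rule mvars_sum)
    fix l
    have "mvars (fps_nth (trunc_pow_fps p n c) l) \<subseteq> ?V" using T by (simp add: graded_fps_def)
    moreover have "mvars (xA n i ^ (p - l)) \<subseteq> ?V"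
      using mvars_power xA_carrier[OF assms] by (rule order_trans)
    ultimately show "mvars (fps_nth (trunc_pow_fps p n c) l * xA n i ^ (p - l)) \<subseteq> ?V"
      using mvars_mult by fastforce
  qed
qed


section \<open>Ideals generated by forms of one degree\<close>

text \<open>
  Substituting \<open>t x\<close> for the variables, with a new indeterminate \<open>t\<close>, turns the homogeneous
  components of a polynomial into the coefficients of a polynomial in \<open>t\<close>.
\<close>

interpretation along: coeff_hom "\<lambda>a::'k::field. [:a:]"
  by unfold_locales (simp_all add: one_pCons)

abbreviation along :: "(nat \<Rightarrow> 'k::field) \<Rightarrow> 'k mpoly \<Rightarrow> 'k poly" where
  "along x \<equiv> msubst (\<lambda>a. [:a:]) (\<lambda>i. [:0, x i:])"

lemma along_homogeneous:
  fixes f :: "'k::field mpoly"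
  assumes "homogeneous d f"
  shows "along x f = monom (meval x f) d"
proof -
  have mono: "(\<Prod>i\<in>S. [:0, x i:] ^ e i) = monom (\<Prod>i\<in>S. x i ^ e i) (\<Sum>i\<in>S. e i)"
    for S :: "nat set" and e
  proof (induction S rule: infinite_finite_induct)
    case (insert i S)
    have "[:0, x i:] = monom (x i) 1" by (simp add: monom_Suc monom_0)
    then have "[:0, x i:] ^ e i = monom (x i ^ e i) (e i)" by (simp only: monom_power) simp
    with insert show ?case by (simp add: mult_monom)
  qed simp_all
  have "along x f = (\<Sum>m\<in>Poly_Mapping.keys f. monom (Poly_Mapping.lookup f m *
      (\<Prod>i\<in>Poly_Mapping.keys m. x i ^ Poly_Mapping.lookup m i)) d)"
    unfolding msubst_def mono using assms
    by (intro sum.cong) (simp_all add: homogeneous_def smult_monom)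
  then show ?thesis by (auto simp: msubst_def poly_eq_iff coeff_sum)
qed

lemma coeff_0_along: "coeff (along x f) 0 = meval (\<lambda>_. 0) f"
  by (simp add: msubst_def poly_sum poly_prod flip: poly_0_coeff_0)

lemma coeff_mult_lowest:
  fixes q r :: "'k::field poly"
  assumes "\<And>j. j < k \<Longrightarrow> coeff q j = 0"
  shows "coeff (r * q) k = coeff r 0 * coeff q k"
proof -
  have "coeff (r * q) k = (\<Sum>j\<in>{0}. coeff r j * coeff q (k - j))"
    unfolding coeff_mult by (rule sum.mono_neutral_right) (use assms in auto)
  then show ?thesis by simp
qed

text \<open>
  In an ideal generated by forms of degree \<open>d\<close>, the component of degree \<open>d\<close> of any element is a
  combination of the generators with constant coefficients: multiplying by \<open>r\<close> multiplies the lowest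
  component by the constant term of \<open>r\<close>. The elements with this property are the ideal \<open>J\<close> of the proof.
\<close>

lemma genideal_same_degree:
  fixes h :: "'i \<Rightarrow> 'k::field mpoly"
  assumes "finite U" and h: "\<And>i. i \<in> U \<Longrightarrow> homogeneous d (h i) \<and> mvars (h i) \<subseteq> V"
    and f: "f \<in> genideal (mpoly_ring V) (h ` U)" "homogeneous d f"
  obtains a where "\<And>x. meval x f = (\<Sum>i\<in>U. a i * meval x (h i))"
proof -
  let ?R = "mpoly_ring V :: 'k mpoly ring"
  interpret R: cring ?R by (rule mpoly_ring_cring)
  define low where "low g a \<longleftrightarrow> (\<forall>x. (\<forall>k<d. coeff (along x g) k = 0) \<and>
      coeff (along x g) d = (\<Sum>i\<in>U. a i * meval x (h i)))" for g and a :: "'i \<Rightarrow> 'k"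
  define J where "J = {g. mvars g \<subseteq> V \<and> (\<exists>a. low g a)}"
  have add: "low (g + g') (\<lambda>i. a i + a' i)" if "low g a" "low g' a'" for g g' a a'
    using that by (simp add: low_def along.msubst_add distrib_right sum.distrib)
  have mult: "low (r * g) (\<lambda>i. meval (\<lambda>_. 0) r * a i)" if "low g a" for r g a
    unfolding low_def
  proof (intro allI conjI impI)
    fix x :: "nat \<Rightarrow> 'k"
    have zero: "coeff (along x g) k = 0" if "k < d" for k
      using that \<open>low g a\<close> by (simp add: low_def)
    have scale: "coeff (along x (r * g)) k = meval (\<lambda>_. 0) r * coeff (along x g) k" if "k \<le> d" for k
      unfolding along.msubst_mult coeff_0_along[of x, symmetric]
      by (rule coeff_mult_lowest) (use that in \<open>simp add: zero\<close>)
    show "coeff (along x (r * g)) k = 0" if "k < d" for k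
      using that by (simp add: scale zero)
    show "coeff (along x (r * g)) d = (\<Sum>i\<in>U. meval (\<lambda>_. 0) r * a i * meval x (h i))"
      using \<open>low g a\<close> by (simp add: scale low_def sum_distrib_left mult.assoc)
  qed
  have mult_closed: "r * g \<in> J" if "g \<in> J" "mvars r \<subseteq> V" for r g
    using that mvars_mult[of r g] mult unfolding J_def by blast
  have J: "ideal J ?R"
  proof (rule idealI)
    show "subgroup J (add_monoid ?R)"
    proof
      show "J \<subseteq> carrier (add_monoid ?R)" by (auto simp: J_def)
      fix g assume g: "g \<in> J"
      have "- g = (-1) * g" by simp
      also have "\<dots> \<in> J" using g by (rule mult_closed) simp
      finally have "- g \<in> J" .
      moreover have "\<ominus>\<^bsub>?R\<^esub> g = - g"
        using g by (intro R.minus_equality) (auto simp: J_def)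
      ultimately show "inv\<^bsub>add_monoid ?R\<^esub> g \<in> J" by (simp add: a_inv_def)
      fix g' assume g': "g' \<in> J"
      have "mvars (g + g') \<subseteq> V" using g g' mvars_add[of g g'] by (auto simp: J_def)
      moreover have "\<exists>a. low (g + g') a" using g g' add unfolding J_def by blast
      ultimately show "g \<otimes>\<^bsub>add_monoid ?R\<^esub> g' \<in> J" by (simp add: J_def)
    next
      have "low 0 (\<lambda>_. 0)" by (simp add: low_def along.msubst_zero)
      then show "\<one>\<^bsub>add_monoid ?R\<^esub> \<in> J" by (auto simp: J_def)
    qed
  qed (use mult_closed in \<open>auto simp: mult.commute intro: R.ring_axioms\<close>)
  have "low (h i) (\<lambda>j. if j = i then 1 else 0)" if "i \<in> U" for i
  proof -
    have "along x (h i) = monom (meval x (h i)) d" for x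
      using h[OF that] by (intro along_homogeneous) simp
    with that \<open>finite U\<close> show ?thesis
      by (simp add: low_def if_distrib[of "\<lambda>b. b * _"] sum.delta cong: if_cong)
  qed
  with h have "h ` U \<subseteq> J" unfolding J_def by blast
  then have "f \<in> J" using R.genideal_minimal[OF J] f(1) by blast
  then obtain a where "low f a" by (auto simp: J_def)
  then have "meval x f = (\<Sum>i\<in>U. a i * meval x (h i))" for x
    using \<open>low f a\<close> by (simp add: low_def along_homogeneous[OF f(2)])
  with that show thesis by blast
qed


section \<open>Linear independence of the generators\<close>

text \<open>
  The points \<open>e\<^sub>i - e\<^sub>k\<close> used below have \<open>g = (1 - z) (1 + z)\<close>.
\<close>

lemma lin_prod_pair:
  fixes s :: "'i \<Rightarrow> 'k::field"
  assumes "finite I" "i \<in> I" "k \<in> I" "s i = 1" "s k = -1" "i \<noteq> k"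
    and "\<And>j. j \<in> I - {i, k} \<Longrightarrow> s j = 0"
  shows "lin_prod I s = [:1, 0, -1:]"
proof -
  have "lin_prod I s = (\<Prod>j\<in>{i, k}. [:1, - s j:])"
    unfolding lin_prod_def by (rule prod.mono_neutral_right) (use assms in \<open>auto simp: one_pCons\<close>)
  then show ?thesis using assms by simp
qed

text \<open>
  The difference is the sum of the coefficients of \<open>T\<close> below degree \<open>p\<close>, an alternating sum of
  binomial coefficients since \<open>g - 1 = - z\<^sup>2\<close>. The bound \<open>K\<close> is the largest \<open>m\<close> with \<open>2 m < p\<close>.
\<close>

lemma quot_coeff_trunc_pow_separates:
  fixes c :: "'k::field"
  assumes p: "CHAR('k) = p" "p > 0" and c: "c \<notin> range of_nat"
  defines "T \<equiv> trunc_pow c (p - 1) [:1, 0, -1:]"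
  shows "quot_coeff p T 1 \<noteq> quot_coeff p T 0"
proof -
  define K where "K = (p - 1) div 2"
  have prime: "prime p" using p prime_CHAR_semidom[where ?'a = 'k] by simp
  have u: "[:1, 0, -1:] - 1 = (monom (-1) 2 :: 'k poly)"
    by (simp add: one_pCons monom_Suc monom_0 numeral_2_eq_2)
  have T: "coeff T l = (\<Sum>m\<le>p-1. if l = 2 * m then (-1) ^ m * binom c m else 0)" for l
    unfolding T_def trunc_pow_def u coeff_sum monom_power
    by (intro sum.cong) (auto simp: mult.commute)
  have "quot_coeff p T 1 - quot_coeff p T 0 = (\<Sum>l\<le>p. coeff T l * (1 - 0 ^ (p - l)))"
    by (simp add: quot_coeff_def sum_subtractf right_diff_distrib)
  also have "\<dots> = (\<Sum>l<p. coeff T l)"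
    by (rule sum.mono_neutral_cong_right) (auto simp: not_less)
  also have "\<dots> = (\<Sum>m\<le>p-1. \<Sum>l<p. if l = 2 * m then (-1) ^ m * binom c m else 0)"
    unfolding T by (rule sum.swap)
  also have "\<dots> = (\<Sum>m\<le>p-1. if 2 * m < p then (-1) ^ m * binom c m else 0)"
    by (simp add: sum.delta)
  also have "\<dots> = (\<Sum>m\<le>K. (-1) ^ m * binom c m)"
    by (rule sum.mono_neutral_cong_right) (use p(2) in \<open>auto simp: K_def\<close>)
  also have "\<dots> = (-1) ^ K * binom (c - 1) K"
  proof (rule sum_alternating_binom)
    fix m assume "0 < m" "m \<le> K"
    with p show "of_nat m \<noteq> (0 :: 'k)" by (intro of_nat_nonzero_below_CHAR) (auto simp: K_def)
  qed
  finally have diff: "quot_coeff p T 1 - quot_coeff p T 0 = (-1) ^ K * binom (c - 1) K" .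
  have "K < p" using p(2) by (simp add: K_def)
  then have "of_nat (fact K) \<noteq> (0 :: 'k)"
    unfolding of_nat_eq_0_iff_char_dvd p(1) using prime by (simp add: prime_dvd_fact_iff)
  moreover have "c - 1 - of_nat i \<noteq> 0" for i
  proof
    assume "c - 1 - of_nat i = 0"
    then have "c = of_nat (Suc i)" by (simp add: algebra_simps)
    with c show False by blast
  qed
  ultimately have "binom (c - 1) K \<noteq> 0" by (simp add: binom_def)
  with diff show ?thesis by auto
qed

text \<open>
  For \<open>n > 2\<close> the two points \<open>x = e\<^sub>i - e\<^sub>k\<close> and \<open>x' = e\<^sub>n - e\<^sub>k\<close> have the same \<open>T\<close>, and their
  coordinates with index below \<open>n\<close> differ only at \<open>i\<close>; subtracting the relation at one from the
  relation at the other isolates \<open>a i\<close>. In the coordinates \<open>x\<^sub>1, \<dots>, x\<^sub>n\<^sub>-\<^sub>1\<close> the point \<open>x'\<close> is \<open>- e\<^sub>k\<close>.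
\<close>

lemma f_gen_independent:
  fixes c :: "'k::field"
  assumes p: "CHAR('k) = p" "p > 0" "p dvd n" and c: "c \<notin> range of_nat"
    and rel: "\<And>x. (\<Sum>j=1..n-1. a j * meval x (f_gen p n c j)) = 0"
    and i: "i \<in> {1..n-1}"
  shows "a i = 0"
proof (cases "n = 2")
  case True
  define x :: "nat \<Rightarrow> 'k" where "x = (\<lambda>_. 1)"
  have "i = 1" using i True by simp
  show ?thesis
  proof (rule ccontr)
    assume "a i \<noteq> 0"
    with rel[of x] \<open>i = 1\<close> have "meval x (f_gen p n c 1) = 0" by (simp add: True)
    moreover have "j = 1" if "j \<in> {1..n} - {n}" for j using that True by auto
    ultimately have "quot_coeff p (trunc_pow c (p - 1) (lin_prod {1..n} (sum_zero_point n x)))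
        (sum_zero_point n x j) = 0" if "j \<in> {1..n} - {n}" for j
      using that meval_f_gen by metis
    then have "sum_zero_point n x 1 = 0"
      using only_trivial_common_zero[of p "{1..n}" "sum_zero_point n x" c n 1] p c True
        sum_sum_zero_point[of n x] by simp
    then show False by (simp add: sum_zero_point_def x_def True)
  qed
next
  case False
  define k where "k = (if i = 1 then 2 else 1 :: nat)"
  have k: "k \<in> {1..n-1}" "k \<noteq> i" using i False by (auto simp: k_def)
  define T where "T = trunc_pow c (p - 1) [:1, 0, -1:]"
  define x x' :: "nat \<Rightarrow> 'k" where "x = (\<lambda>j. if j = i then 1 else if j = k then -1 else 0)"
    and "x' = (\<lambda>j. if j = k then -1 else 0)"
  have sums: "(\<Sum>j=1..n-1. x j) = 0" "(\<Sum>j=1..n-1. x' j) = -1"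
  proof -
    have "(\<Sum>j=1..n-1. x' j) = (\<Sum>j=1..n-1. if j = k then -1 else 0)" by (simp only: x'_def)
    then show s': "(\<Sum>j=1..n-1. x' j) = -1" using k(1) by (simp add: sum.delta)
    have "(\<Sum>j=1..n-1. x j) = (\<Sum>j=1..n-1. (if j = i then 1 else 0) + x' j)"
      using k(2) by (intro sum.cong) (auto simp: x_def x'_def)
    also have "\<dots> = 1 + (\<Sum>j=1..n-1. x' j)" using i by (simp add: sum.distrib sum.delta)
    also have "\<dots> = 0" unfolding s' by simp
    finally show "(\<Sum>j=1..n-1. x j) = 0" .
  qed
  have pt: "sum_zero_point n x j = (if j = i then 1 else if j = k then -1 else 0)"
    "sum_zero_point n x' j = (if j = n then 1 else if j = k then -1 else 0)" for j
    using sums i k by (auto simp: sum_zero_point_def x_def[THEN fun_cong] x'_def[THEN fun_cong])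
  have lin: "lin_prod {1..n} (sum_zero_point n x) = [:1, 0, -1:]"
    by (rule lin_prod_pair[of _ i k]) (use i k in \<open>auto simp: pt\<close>)
  have lin': "lin_prod {1..n} (sum_zero_point n x') = [:1, 0, -1:]"
    by (rule lin_prod_pair[of _ n k]) (use i k in \<open>auto simp: pt\<close>)
  have "0 = (\<Sum>j=1..n-1. a j * meval x (f_gen p n c j)) - (\<Sum>j=1..n-1. a j * meval x' (f_gen p n c j))"
    by (simp only: rel diff_self)
  also have "\<dots> = (\<Sum>j=1..n-1. a j * (quot_coeff p T (sum_zero_point n x j) - quot_coeff p T (sum_zero_point n x' j)))"
    unfolding meval_f_gen lin lin' T_def[symmetric] by (simp add: sum_subtractf right_diff_distrib)
  also have "\<dots> = (\<Sum>j=1..n-1. if j = i then a i * (quot_coeff p T 1 - quot_coeff p T 0) else 0)"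
    using k by (intro sum.cong) (auto simp: pt)
  also have "\<dots> = a i * (quot_coeff p T 1 - quot_coeff p T 0)"
    using i by (simp add: sum.delta)
  finally show ?thesis
    using quot_coeff_trunc_pow_separates[OF p(1,2) c] by (simp add: T_def)
qed

lemma f_gen_not_in_span:
  fixes c :: "'k::field"
  assumes p: "CHAR('k) = p" "p > 0" "p dvd n" and c: "c \<notin> range of_nat"
    and i: "i \<in> {1..n-1}" and U: "U \<subseteq> {1..n-1} - {i}"
  shows "\<not> (\<forall>x. meval x (f_gen p n c i) = (\<Sum>j\<in>U. a j * meval x (f_gen p n c j)))"
proof
  assume span: "\<forall>x. meval x (f_gen p n c i) = (\<Sum>j\<in>U. a j * meval x (f_gen p n c j))"
  define b where "b = (\<lambda>j. if j = i then 1 else if j \<in> U then - a j else 0)"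
  have "(\<Sum>j=1..n-1. b j * meval x (f_gen p n c j)) = 0" for x
  proof -
    have "(\<Sum>j=1..n-1. b j * meval x (f_gen p n c j)) = (\<Sum>j\<in>insert i U. b j * meval x (f_gen p n c j))"
      by (rule sum.mono_neutral_right) (use i U in \<open>auto simp: b_def\<close>)
    also have "\<dots> = b i * meval x (f_gen p n c i) + (\<Sum>j\<in>U. b j * meval x (f_gen p n c j))"
      using U by (intro sum.insert) (auto intro: finite_subset)
    also have "(\<Sum>j\<in>U. b j * meval x (f_gen p n c j)) = - (\<Sum>j\<in>U. a j * meval x (f_gen p n c j))"
      unfolding sum_negf[symmetric] using U by (intro sum.cong) (auto simp: b_def)
    finally show ?thesis using span by (simp add: b_def)
  qed
  then have "b i = 0" by (rule f_gen_independent[OF p c _ i])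
  then show False by (simp add: b_def)
qed


section \<open>The complete intersection property\<close>

lemma proj_zeros_I_ideal:
  fixes c :: "'k::field"
  assumes p: "CHAR('k) = p" "p > 0" and n: "n > 0" "p dvd n" and c: "c \<notin> range of_nat"
  shows "proj_zeros {1..n-1} (I_ideal p n c) = {}"
proof (rule ccontr)
  interpret R: cring "mpoly_ring {1..n-1} :: 'k mpoly ring" by (rule mpoly_ring_cring)
  assume "proj_zeros {1..n-1} (I_ideal p n c) \<noteq> {}"
  then obtain P where P: "P \<in> proj_space {1..n-1}" "\<forall>f\<in>I_ideal p n c. \<forall>x\<in>P. meval x f = 0"
    by (auto simp: proj_zeros_def)
  obtain x where x: "x \<in> nonzero_vectors {1..n-1}" "x \<in> P"
  proof (rule quotientE[OF P(1)[unfolded proj_space_def]])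
    fix x :: "nat \<Rightarrow> 'k"
    assume x: "x \<in> nonzero_vectors {1..n-1}" and "P = {(x, y). x \<in> nonzero_vectors {1..n-1} \<and>
      y \<in> nonzero_vectors {1..n-1} \<and> (\<exists>t. t \<noteq> 0 \<and> y = (\<lambda>i. t * x i))} `` {x}"
    moreover have "\<exists>t. t \<noteq> 0 \<and> x = (\<lambda>i. t * x i)" by (rule exI[of _ 1]) simp
    ultimately have "x \<in> P" by blast
    with x show thesis by (rule that)
  qed
  have sub: "f_gen p n c ` {1..n-1} \<subseteq> I_ideal p n c"
    unfolding I_ideal_def A_ring_def
  proof (rule R.genideal_self, rule image_subsetI)
    fix i assume "i \<in> {1..n-1}"
    then have "i \<in> {1..n}" by auto
    then show "f_gen p n c i \<in> carrier (mpoly_ring {1..n-1})"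
      using f_gen_graded(2) by simp
  qed
  have zero: "quot_coeff p (trunc_pow c (p - 1) (lin_prod {1..n} (sum_zero_point n x))) (sum_zero_point n x j) = 0"
    if "j \<in> {1..n} - {n}" for j
  proof -
    have "j \<in> {1..n-1}" using that by auto
    then have "meval x (f_gen p n c j) = 0" using sub P(2) x(2) by blast
    then show ?thesis unfolding meval_f_gen .
  qed
  have "x j = 0" if "j \<in> {1..n-1}" for j
  proof -
    have "sum_zero_point n x j = 0"
      by (rule only_trivial_common_zero[OF p _ sum_sum_zero_point[OF n(1)] _ c, where j = n])
        (use n zero that in auto)
    moreover have "j \<noteq> n" using that n(1) by auto
    ultimately show ?thesis by (simp add: sum_zero_point_def)
  qed
  with x(1) show False unfolding nonzero_vectors_def by blast
qed

lemma has_proj_dim_empty: "has_proj_dim V {} (-1)"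
  by (auto simp: has_proj_dim_def irreducible_chain_def irreducible_closed_def)

theorem proposition3p1:
  fixes n p :: nat
  assumes "CHAR('k::alg_closed_field) = p" and "p > 0"
    and "n > 0" and "p dvd n"
  shows "\<exists>S::'k set. finite S \<and> (\<forall>c. c \<notin> S \<longrightarrow> complete_intersection {1..n-1} (I_ideal p n c))"
proof (intro exI[of _ "range of_nat"] conjI allI impI)
  show "finite (range of_nat :: 'k set)" using assms by (intro finite_prime_field) simp
  fix c :: 'k assume c: "c \<notin> range of_nat"
  let ?V = "{1..n-1}" and ?f = "f_gen p n c"
  interpret R: cring "mpoly_ring ?V :: 'k mpoly ring" by (rule mpoly_ring_cring)
  have graded: "homogeneous p (?f i) \<and> mvars (?f i) \<subseteq> ?V" if "i \<in> ?V" for i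
  proof -
    have "i \<in> {1..n}" using that by auto
    then show ?thesis using f_gen_graded by blast
  qed
  then have carrier: "?f ` ?V \<subseteq> carrier (mpoly_ring ?V)"
    unfolding mpoly_ring_simps by blast
  \<comment> \<open>Equal generators would reduce their number, and with it the expected codimension.\<close>
  have "inj_on ?f ?V"
  proof (rule inj_onI, rule ccontr)
    fix i j assume "i \<in> ?V" "j \<in> ?V" "?f i = ?f j" "i \<noteq> j"
    then show False
      using f_gen_not_in_span[OF assms(1,2,4) c, of i "{j}" "\<lambda>_. 1"] by simp
  qed
  then have card: "card (?f ` ?V) = n - 1" by (simp add: card_image)
  have "minimal_generators ?V (I_ideal p n c) (?f ` ?V)"
    unfolding minimal_generators_def
  proof (intro conjI allI impI)
    show "genideal (mpoly_ring ?V) (?f ` ?V) = I_ideal p n c" by (simp add: I_ideal_def A_ring_def)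
    fix G assume G: "G \<subset> ?f ` ?V"
    then obtain i where i: "i \<in> ?V" "?f i \<notin> G" by blast
    define U where "U = {j \<in> ?V. ?f j \<in> G}"
    have GU: "G = ?f ` U" using G by (auto simp: U_def)
    show "genideal (mpoly_ring ?V) G \<noteq> I_ideal p n c"
    proof
      assume eq: "genideal (mpoly_ring ?V) G = I_ideal p n c"
      have "?f ` ?V \<subseteq> genideal (mpoly_ring ?V) (?f ` ?V)"
        by (rule R.genideal_self[OF carrier])
      with i(1) eq have "?f i \<in> genideal (mpoly_ring ?V) (?f ` U)"
        by (auto simp: I_ideal_def A_ring_def GU)
      then obtain a where "\<And>x. meval x (?f i) = (\<Sum>j\<in>U. a j * meval x (?f j))"
        using genideal_same_degree[of U p ?f ?V "?f i"] graded i(1) by (auto simp: U_def)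
      moreover have "U \<subseteq> ?V - {i}" using i(2) by (auto simp: U_def)
      ultimately show False using f_gen_not_in_span[OF assms(1,2,4) c i(1)] by blast
    qed
  qed (use graded carrier in blast)+
  moreover have "has_proj_dim ?V (proj_zeros ?V (I_ideal p n c)) (int (card ?V) - 1 - int (card (?f ` ?V)))"
    unfolding proj_zeros_I_ideal[OF assms c] card by (simp add: has_proj_dim_empty)
  ultimately show "complete_intersection ?V (I_ideal p n c)"
    unfolding complete_intersection_def by blast
qed

end
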